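(* Let $G$ be a signed graph. Then $G$ has a unique Laplacian inertia if and only if no block of $G$ has both a positive edge and a negative edge.
   Context: A signed graph is a simple graph $G=(V(G),E(G))$ with vertex set $V(G)=\{1,\dots,n\}$ (possibly disconnected) together with an assignment of a sign $+$ or $-$ to each edge; edges are called positive or negative accordingly. A consistent weighting $\gamma$ of $G$ assigns to each edge $ij$ a nonzero real number $\gamma_{ij}$ whose sign is the sign of the edge; $\Gamma=(G,\gamma)$ is then a weighted signed graph. Its Laplacian is $L(\Gamma)=L(G,\gamma)=A-D$, where $A=[a_{ij}]$ is the symmetric $n\times n$ matrix with $a_{ij}=\gamma_{ij}$ if $ij\in E(G)$ and $a_{ij}=0$ otherwise, and $D=\mathrm{diag}(d_1,\dots,d_n)$ with $d_i$ the sum of the weights of the edges incident to vertex $i$. The Laplacian inertia of $\Gamma$ is $IL(\Gamma)=(n_+,n_-,n_0)$, the numbers of positive, negative and zero eigenvalues of $L(\Gamma)$, counted with multiplicity. $G$ has unique Laplacian inertia if $IL(G,\gamma)$ is the same triple for all consistent weightings $\gamma$ of $G$. A block of a graph is a maximal connected subgraph with no cut vertex. *)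

theory Defs
  imports "Jordan_Normal_Form.Char_Poly"
begin

record 'a ugraph =
  verts :: "'a set"
  edges :: "'a set set"

definition simple_graph :: "'a ugraph \<Rightarrow> bool" where
  "simple_graph G \<longleftrightarrow> finite (verts G) \<and> (\<forall>e\<in>edges G. e \<subseteq> verts G \<and> card e = 2)"

definition subgraph :: "'a ugraph \<Rightarrow> 'a ugraph \<Rightarrow> bool" where
  "subgraph H G \<longleftrightarrow> simple_graph H \<and> verts H \<subseteq> verts G \<and> edges H \<subseteq> edges G"

definition joined :: "'a ugraph \<Rightarrow> 'a \<Rightarrow> 'a \<Rightarrow> bool" where
  "joined G u w \<longleftrightarrow> u \<in> verts G \<and> w \<in> verts G \<and> (u, w) \<in> {(x, y). {x, y} \<in> edges G}\<^sup>*"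

text \<open>The empty graph does not count as connected.\<close>
definition connected_graph :: "'a ugraph \<Rightarrow> bool" where
  "connected_graph G \<longleftrightarrow> verts G \<noteq> {} \<and> (\<forall>u\<in>verts G. \<forall>w\<in>verts G. joined G u w)"

definition delete_vertex :: "'a ugraph \<Rightarrow> 'a \<Rightarrow> 'a ugraph" where
  "delete_vertex G v = \<lparr>verts = verts G - {v}, edges = {e \<in> edges G. v \<notin> e}\<rparr>"

text \<open>A cut vertex separates two other vertices of the same component. In particular
  graphs with one vertex, or with two vertices, have no cut vertex.\<close>
definition cut_vertex :: "'a ugraph \<Rightarrow> 'a \<Rightarrow> bool" where
  "cut_vertex G v \<longleftrightarrow> v \<in> verts G \<and>
     (\<exists>u\<in>verts G - {v}. \<exists>w\<in>verts G - {v}. joined G u w \<and> \<not> joined (delete_vertex G v) u w)"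

definition connected_no_cut :: "'a ugraph \<Rightarrow> bool" where
  "connected_no_cut G \<longleftrightarrow> connected_graph G \<and> \<not> (\<exists>v. cut_vertex G v)"

definition block :: "'a ugraph \<Rightarrow> 'a ugraph \<Rightarrow> bool" where
  "block G B \<longleftrightarrow> subgraph B G \<and> connected_no_cut B \<and>
     (\<forall>B'. subgraph B' G \<and> connected_no_cut B' \<and> subgraph B B' \<longrightarrow> B' = B)"

datatype sign = Positive | Negative

text \<open>The vertices are \<open>0, \<dots>, n - 1\<close>, matching the row and column indices of
  \<open>n \<times> n\<close> matrices. The value of the sign function outside the edge set is irrelevant,
  and likewise for weightings below.\<close>
record signed_graph = "nat ugraph" +
  edge_sign :: "nat set \<Rightarrow> sign"

definition underlying :: "signed_graph \<Rightarrow> nat ugraph" where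
  "underlying G = \<lparr>verts = verts G, edges = edges G\<rparr>"

definition signed_graph_on :: "nat \<Rightarrow> signed_graph \<Rightarrow> bool" where
  "signed_graph_on n G \<longleftrightarrow> simple_graph (underlying G) \<and> verts G = {..<n}"

definition consistent_weighting :: "signed_graph \<Rightarrow> (nat set \<Rightarrow> real) \<Rightarrow> bool" where
  "consistent_weighting G \<gamma> \<longleftrightarrow>
     (\<forall>e\<in>edges G. case edge_sign G e of Positive \<Rightarrow> \<gamma> e > 0 | Negative \<Rightarrow> \<gamma> e < 0)"

definition weighted_adjacency :: "nat \<Rightarrow> signed_graph \<Rightarrow> (nat set \<Rightarrow> real) \<Rightarrow> real mat" where
  "weighted_adjacency n G \<gamma> = mat n n (\<lambda>(i, j). if {i, j} \<in> edges G then \<gamma> {i, j} else 0)"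

definition weighted_degree :: "nat \<Rightarrow> signed_graph \<Rightarrow> (nat set \<Rightarrow> real) \<Rightarrow> real mat" where
  "weighted_degree n G \<gamma> =
     mat n n (\<lambda>(i, j). if i = j then \<Sum>e | e \<in> edges G \<and> i \<in> e. \<gamma> e else 0)"

text \<open>Note the sign convention: adjacency minus degree.\<close>
definition laplacian :: "nat \<Rightarrow> signed_graph \<Rightarrow> (nat set \<Rightarrow> real) \<Rightarrow> real mat" where
  "laplacian n G \<gamma> = weighted_adjacency n G \<gamma> - weighted_degree n G \<gamma>"

text \<open>Number of real eigenvalues in \<open>S\<close>, counted with algebraic multiplicity.\<close>
definition eigenvalue_count :: "real mat \<Rightarrow> real set \<Rightarrow> nat" where
  "eigenvalue_count M S = (\<Sum>x | eigenvalue M x \<and> x \<in> S. Polynomial.order x (char_poly M))"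

definition laplacian_inertia ::
  "nat \<Rightarrow> signed_graph \<Rightarrow> (nat set \<Rightarrow> real) \<Rightarrow> nat \<times> nat \<times> nat" where
  "laplacian_inertia n G \<gamma> =
     (eigenvalue_count (laplacian n G \<gamma>) {0<..},
      eigenvalue_count (laplacian n G \<gamma>) {..<0},
      eigenvalue_count (laplacian n G \<gamma>) {0})"

definition unique_laplacian_inertia :: "nat \<Rightarrow> signed_graph \<Rightarrow> bool" where
  "unique_laplacian_inertia n G \<longleftrightarrow>
     (\<forall>\<gamma> \<gamma>'. consistent_weighting G \<gamma> \<and> consistent_weighting G \<gamma>' \<longrightarrow>
        laplacian_inertia n G \<gamma> = laplacian_inertia n G \<gamma>')"

end

theory Submission
  imports Defs "HOL-Analysis.Function_Topology"
begin

text \<open>With \<open>a i j\<close> the edge weights, the quadratic form of the Laplacian is minus half the sum of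
  \<open>a i j * (x i - x j)\<^sup>2\<close>. Both sides of the equivalence say that every potential \<open>x\<close> splits as
  \<open>x = y + z\<close> with \<open>y\<close> constant along negative and \<open>z\<close> constant along positive edges.

  Given such splittings, sending the positive eigenvectors of one Laplacian to their \<open>z\<close>-parts
  produces a subspace of the same dimension on which the form of any other weighting is positive
  definite; so the inertia is unique. Conversely, letting the weights of one sign tend to \<open>0\<close> in
  the unique inertia \<open>(p, q, r)\<close> shows that the Laplacians of the negative and the positive part
  have rank at most \<open>p\<close> and \<open>q\<close>. Their kernels have dimensions adding up to at least \<open>n + r\<close>
  and meet in dimension at most \<open>r\<close>, so they span the whole space.

  If no block is mixed, splittings are glued at cut vertices. In a mixed block some vertex \<open>v\<close> has
  edges of both signs, and the indicator of \<open>v\<close> does not split, because its two neighbours are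
  joined by a path avoiding \<open>v\<close>.\<close>

section \<open>Spectral theorem for real symmetric matrices\<close>

text \<open>Gaussian elimination, one equation at a time. The dimension counts below reduce to this;
  unknowns may be indexed by any type, so that \<open>kernel_decomposition\<close> can use a sum
  type.\<close>

lemma underdetermined_system:
  fixes F :: "'i \<Rightarrow> 'j \<Rightarrow> real"
  assumes "finite I" "finite J" "card I < card J"
  obtains c where "\<exists>j\<in>J. c j \<noteq> 0" "\<And>i. i \<in> I \<Longrightarrow> (\<Sum>j\<in>J. F i j * c j) = 0"
proof -
  have "\<exists>c. (\<exists>j\<in>J. c j \<noteq> 0) \<and> (\<forall>i\<in>I. (\<Sum>j\<in>J. F i j * c j) = 0)"
    using assms
  proof (induction I arbitrary: J F rule: finite_induct)
    case empty
    then obtain j where "j \<in> J" by fastforce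
    then show ?case by (intro exI[of _ "\<lambda>_. 1"]) auto
  next
    case (insert i I)
    show ?case
    proof (cases "\<forall>j\<in>J. F i j = 0")
      case True
      from insert.IH[of J F] insert.prems insert.hyps True show ?thesis by (auto simp: card_insert_if)
    next
      case False
      then obtain j0 where j0: "j0 \<in> J" "F i j0 \<noteq> 0" by blast
      define J' where "J' = J - {j0}"
      have J: "J = insert j0 J'" "j0 \<notin> J'" "finite J'" using j0 insert.prems by (auto simp: J'_def)
      have "card I < card J'" using insert.prems insert.hyps J by simp
      then obtain c where c: "\<exists>j\<in>J'. c j \<noteq> 0"
        "\<forall>i'\<in>I. (\<Sum>j\<in>J'. (F i' j - F i' j0 * F i j / F i j0) * c j) = 0"
        using insert.IH[of J' "\<lambda>i' j. F i' j - F i' j0 * F i j / F i j0"] J by blast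
      \<comment> \<open>Equation \<open>i\<close> is solved for the pivot unknown \<open>j0\<close>;
        substituting it in the other equations gave the coefficients used for
        \<open>c\<close>.\<close>
      define t where "t = - (\<Sum>j\<in>J'. F i j * c j) / F i j0"
      define d where "d = c(j0 := t)"
      have S: "(\<Sum>j\<in>J. G j * d j) = G j0 * t + (\<Sum>j\<in>J'. G j * c j)" for G
        unfolding J(1) using J(2,3) by (auto simp: d_def intro!: sum.cong)
      have "(\<Sum>j\<in>J. F i' j * d j) = 0" if "i' \<in> insert i I" for i'
      proof (cases "i' = i")
        case True
        then show ?thesis using j0 by (simp add: S t_def)
      next
        case False
        then have "i' \<in> I" using that by simp
        with c(2) have "(\<Sum>j\<in>J'. (F i' j - F i' j0 * F i j / F i j0) * c j) = 0" by blast
        then have "(\<Sum>j\<in>J'. F i' j * c j) = F i' j0 / F i j0 * (\<Sum>j\<in>J'. F i j * c j)"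
          by (simp only: left_diff_distrib sum_subtractf sum_distrib_left) (simp add: mult_ac)
        then show ?thesis by (simp add: S t_def)
      qed
      moreover have "\<exists>j\<in>J. d j \<noteq> 0" using c(1) J by (auto simp: d_def)
      ultimately show ?thesis by blast
    qed
  qed
  then show ?thesis using that by blast
qed

text \<open>Vectors are total functions of which only the values below \<open>n\<close> count, so
  equalities of vectors are stated for \<open>i < n\<close>.\<close>

definition ip :: "nat \<Rightarrow> (nat \<Rightarrow> real) \<Rightarrow> (nat \<Rightarrow> real) \<Rightarrow> real" where
  "ip n x y = (\<Sum>i<n. x i * y i)"

definition app :: "nat \<Rightarrow> (nat \<Rightarrow> nat \<Rightarrow> real) \<Rightarrow> (nat \<Rightarrow> real) \<Rightarrow> nat \<Rightarrow> real" where
  "app n A x = (\<lambda>i. \<Sum>j<n. A i j * x j)"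

lemma ip_commute: "ip n x y = ip n y x"
  by (simp add: ip_def mult.commute)

lemma ip_add_left: "ip n (\<lambda>i. x i + y i) z = ip n x z + ip n y z"
  by (simp add: ip_def distrib_right sum.distrib)

lemma ip_diff_left: "ip n (\<lambda>i. x i - y i) z = ip n x z - ip n y z"
  by (simp add: ip_def left_diff_distrib sum_subtractf)

lemma ip_scale_left: "ip n (\<lambda>i. t * x i) z = t * ip n x z"
  by (simp add: ip_def sum_distrib_left mult_ac)

lemma ip_sum_left: "ip n (\<lambda>i. \<Sum>j\<in>J. c j * w j i) z = (\<Sum>j\<in>J. c j * ip n (w j) z)"
  by (simp add: ip_def sum_distrib_left sum_distrib_right mult_ac) (rule sum.swap)

lemma ip_add_right: "ip n z (\<lambda>i. x i + y i) = ip n z x + ip n z y"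
  by (simp add: ip_commute[of n z] ip_add_left)

lemma ip_diff_right: "ip n z (\<lambda>i. x i - y i) = ip n z x - ip n z y"
  by (simp add: ip_commute[of n z] ip_diff_left)

lemma ip_scale_right: "ip n z (\<lambda>i. t * x i) = t * ip n z x"
  by (simp add: ip_commute[of n z] ip_scale_left)

lemma ip_cong: "(\<And>i. i < n \<Longrightarrow> x i = x' i) \<Longrightarrow> (\<And>i. i < n \<Longrightarrow> y i = y' i) \<Longrightarrow> ip n x y = ip n x' y'"
  by (simp add: ip_def)

lemma ip_self_nonneg: "0 \<le> ip n x x"
  by (simp add: ip_def sum_nonneg)

lemma ip_self_eq_0: "ip n x x = 0 \<longleftrightarrow> (\<forall>i<n. x i = 0)"
  by (auto simp: ip_def sum_nonneg_eq_0_iff)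

lemma app_add: "app n A (\<lambda>i. x i + y i) = (\<lambda>i. app n A x i + app n A y i)"
  by (simp add: app_def distrib_left sum.distrib)

lemma app_scale: "app n A (\<lambda>i. t * x i) = (\<lambda>i. t * app n A x i)"
  by (simp add: app_def sum_distrib_left mult_ac)

lemma ip_app_symmetric:
  assumes "\<And>i j. i < n \<Longrightarrow> j < n \<Longrightarrow> A i j = A j i"
  shows "ip n x (app n A y) = ip n (app n A x) y"
proof -
  have "ip n x (app n A y) = (\<Sum>i<n. \<Sum>j<n. A i j * x i * y j)"
    by (simp add: ip_def app_def sum_distrib_left mult_ac)
  also have "\<dots> = (\<Sum>j<n. \<Sum>i<n. A i j * x i * y j)" by (rule sum.swap)
  also have "\<dots> = (\<Sum>j<n. \<Sum>i<n. A j i * x i * y j)" using assms by (auto intro!: sum.cong)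
  also have "\<dots> = ip n (app n A x) y" by (simp add: ip_def app_def sum_distrib_right)
  finally show ?thesis .
qed

text \<open>Fixing the coordinates from \<open>n\<close> on to 0 makes the set a closed part of a
  product of compact intervals, to which Tychonoff's theorem applies.\<close>

lemma compact_unit_vectors:
  "compact {x. (\<forall>i\<ge>n. x i = 0) \<and> ip n x x = 1 \<and> (\<forall>p<k. ip n x (v p) = 0)}" (is "compact ?S")
proof -
  define B where "B = PiE UNIV (\<lambda>i. if i < n then {-1..1::real} else {0})"
  have "compact B"
    using compactin_PiE[of "\<lambda>_. euclidean" UNIV "\<lambda>i. if i < n then {-1..1::real} else {0}"]
    unfolding B_def euclidean_product_topology by (auto simp: compactin_euclidean_iff)
  moreover have "?S = B \<inter> {x. ip n x x = 1} \<inter> (\<Inter>p\<in>{..<k}. {x. ip n x (v p) = 0})"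
  proof -
    have "x i \<in> {-1..1}" if "ip n x x = 1" "i < n" for x i
    proof -
      have "x i * x i \<le> (\<Sum>i<n. x i * x i)" by (rule member_le_sum) (use that in auto)
      then have "(x i)\<^sup>2 \<le> 1" using that by (simp add: ip_def power2_eq_square)
      then show ?thesis by (simp add: abs_square_le_1 abs_le_iff)
    qed
    then show ?thesis unfolding B_def by (force simp: PiE_def split: if_splits)
  qed
  moreover have "closed {x. ip n x y = (c::real)}" "closed {x. ip n x x = (c::real)}" for y c
    unfolding ip_def by (intro closed_Collect_eq continuous_intros; simp)+
  ultimately show ?thesis by (auto intro!: compact_Int_closed)
qed

text \<open>First-order test at a maximum: for small positive \<open>t\<close> a nonzero linear term
  would exceed the quadratic one.\<close>

lemma linear_le_quadratic_imp_zero: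
  fixes a b :: real
  assumes "0 \<le> a" "\<And>t. t * a \<le> t\<^sup>2 * b"
  shows "a = 0"
proof (rule ccontr)
  assume "a \<noteq> 0"
  then have a: "a > 0" using assms(1) by simp
  define t where "t = a / (2 * (\<bar>b\<bar> + 1))"
  have t: "t > 0" using a by (simp add: t_def)
  have "t * a \<le> t * (t * b)" using assms(2)[of t] by (simp add: power2_eq_square)
  then have "a \<le> t * b" using t by simp
  also have "t * b \<le> t * (\<bar>b\<bar> + 1)" using t by (intro mult_left_mono) auto
  also have "\<dots> = a / 2" by (simp add: t_def field_simps)
  finally show False using a by simp
qed

text \<open>A maximiser of the Rayleigh quotient on the orthogonal complement of the eigenvectors
  found so far is a further eigenvector.\<close>
lemma exists_orthogonal_eigenvector:
  assumes sym: "\<And>i j. i < n \<Longrightarrow> j < n \<Longrightarrow> A i j = A j i"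
    and "k < n"
    and eig: "\<And>p i. p < k \<Longrightarrow> i < n \<Longrightarrow> app n A (v p) i = l p * v p i"
  obtains x m where "ip n x x = 1" "\<And>p. p < k \<Longrightarrow> ip n x (v p) = 0"
    "\<And>i. i < n \<Longrightarrow> app n A x i = m * x i"
proof -
  define S where "S = {x. (\<forall>i\<ge>n. x i = 0) \<and> ip n x x = 1 \<and> (\<forall>p<k. ip n x (v p) = 0)}"
  \<comment> \<open>The \<open>k < n\<close> orthogonality conditions in \<open>n\<close> unknowns
    leave a nonzero solution; scaled to norm 1 it shows that \<open>S\<close> is nonempty.\<close>
  obtain c where c: "\<exists>j\<in>{..<n}. c j \<noteq> 0" "\<And>p. p \<in> {..<k} \<Longrightarrow> (\<Sum>j<n. v p j * c j) = 0"
    using underdetermined_system[of "{..<k}" "{..<n}" v] \<open>k < n\<close> by auto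
  have c0: "ip n c c > 0" using c(1) ip_self_nonneg[of n c] ip_self_eq_0[of n c]
    by (auto simp: less_le)
  define c' where "c' = (\<lambda>i. if i < n then 1 / sqrt (ip n c c) * c i else 0)"
  have c': "ip n c' y = 1 / sqrt (ip n c c) * ip n c y" for y
    unfolding ip_scale_left[symmetric] by (rule ip_cong) (auto simp: c'_def)
  have "ip n c (v p) = 0" if "p < k" for p
    using c(2)[of p] that by (simp add: ip_def mult.commute)
  moreover have "ip n c' c' = 1"
    using c0 by (simp add: c' ip_commute[of n c c'])
  ultimately have "c' \<in> S"
    by (simp add: S_def c') (simp add: c'_def)
  moreover have "compact S" unfolding S_def by (rule compact_unit_vectors)
  moreover have "continuous_on S (\<lambda>x. ip n x (app n A x))"
    unfolding ip_def app_def
    by (intro continuous_intros continuous_on_subset[OF continuous_on_product_coordinates]) auto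
  ultimately obtain x where x: "x \<in> S"
    and max: "\<And>y. y \<in> S \<Longrightarrow> ip n y (app n A y) \<le> ip n x (app n A x)"
    using continuous_attains_sup[of S "\<lambda>x. ip n x (app n A x)"] by blast
  define m where "m = ip n x (app n A x)"
  have x1: "ip n x x = 1" and xv: "\<And>p. p < k \<Longrightarrow> ip n x (v p) = 0" using x by (auto simp: S_def)
  \<comment> \<open>Homogeneity extends the maximum over unit vectors to the whole orthogonal
    complement.\<close>
  have bound: "ip n y (app n A y) \<le> m * ip n y y" if "\<And>p. p < k \<Longrightarrow> ip n y (v p) = 0" for y
  proof (cases "ip n y y = 0")
    case True
    then have "ip n y (app n A y) = ip n (\<lambda>_. 0) (app n A y)"
      by (intro ip_cong) (auto simp: ip_self_eq_0)
    with True show ?thesis by (simp add: ip_def)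
  next
    case False
    then have y0: "ip n y y > 0" using ip_self_nonneg[of n y] by simp
    define s where "s = 1 / sqrt (ip n y y)"
    have s2: "s * s * ip n y y = 1" using y0 by (simp add: s_def)
    define y' where "y' = (\<lambda>i. if i < n then s * y i else 0)"
    have y': "ip n y' z = s * ip n y z" for z
      unfolding ip_scale_left[symmetric] by (rule ip_cong) (auto simp: y'_def)
    have y'': "ip n z y' = s * ip n z y" for z
      using y' by (simp add: ip_commute[of n z])
    have Ay': "app n A y' = (\<lambda>i. s * app n A y i)"
      by (auto simp: y'_def app_def sum_distrib_left mult_ac intro!: sum.cong)
    have "y' \<in> S" using s2 that by (simp add: S_def y' y'' mult.assoc) (simp add: y'_def)
    from max[OF this] have "s * s * ip n y (app n A y) \<le> m"
      by (simp add: y' y'' Ay' ip_scale_right m_def mult.assoc)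
    then have "s * s * ip n y (app n A y) * ip n y y \<le> m * ip n y y"
      using y0 by (simp add: mult_right_mono)
    also have "s * s * ip n y (app n A y) * ip n y y = ip n y (app n A y)"
      using s2 by (simp add: mult.assoc mult.left_commute[of "ip n y (app n A y)"])
    finally show ?thesis .
  qed
  define r where "r = (\<lambda>i. app n A x i - m * x i)"
  \<comment> \<open>A symmetric matrix leaves the orthogonal complement of eigenvectors invariant,
    so the residual \<open>r\<close> is an admissible direction of variation.\<close>
  have rv: "ip n r (v p) = 0" if "p < k" for p
  proof -
    have "ip n (app n A x) (v p) = ip n x (app n A (v p))" using ip_app_symmetric[OF sym] by simp
    also have "\<dots> = ip n x (\<lambda>i. l p * v p i)" by (rule ip_cong) (use eig that in auto)
    finally show ?thesis using xv[OF that]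
      by (simp add: r_def ip_diff_left ip_scale_left ip_scale_right)
  qed
  have xr: "ip n x r = 0"
    by (simp add: r_def ip_diff_right ip_scale_right x1 m_def)
  then have rx: "ip n r x = 0" by (simp add: ip_commute[of n r x])
  have rAx: "ip n r (app n A x) = ip n r r"
  proof -
    have "ip n r r = ip n r (\<lambda>i. app n A x i - m * x i)" by (simp add: r_def)
    then show ?thesis by (simp add: ip_diff_right ip_scale_right rx)
  qed
  have xAr: "ip n x (app n A r) = ip n r r"
    using ip_app_symmetric[where A = A and x = x and y = r, OF sym] rAx
      ip_commute[of n r "app n A x"] by simp
  \<comment> \<open>Moving from \<open>x\<close> to \<open>x + t * r\<close> gains
    \<open>2 * t * ip n r r\<close> to first order, while maximality allows a gain of second order
    only.\<close>
  have "ip n r r = 0"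
  proof (rule linear_le_quadratic_imp_zero)
    show "0 \<le> ip n r r" by (rule ip_self_nonneg)
    fix t :: real
    have "ip n (\<lambda>i. x i + t * r i) (app n A (\<lambda>i. x i + t * r i))
      \<le> m * ip n (\<lambda>i. x i + t * r i) (\<lambda>i. x i + t * r i)"
      by (rule bound) (simp add: ip_add_left ip_scale_left xv rv)
    moreover have "ip n (\<lambda>i. x i + t * r i) (app n A (\<lambda>i. x i + t * r i))
      = m + 2 * t * ip n r r + t\<^sup>2 * ip n r (app n A r)"
      by (simp add: app_add app_scale ip_add_left ip_add_right ip_scale_left ip_scale_right
          rAx xAr m_def[symmetric]) (simp add: power2_eq_square)
    moreover have "ip n (\<lambda>i. x i + t * r i) (\<lambda>i. x i + t * r i) = 1 + t\<^sup>2 * ip n r r"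
      by (simp add: ip_add_left ip_add_right ip_scale_left ip_scale_right x1 xr rx power2_eq_square)
    ultimately show "t * ip n r r \<le> t\<^sup>2 * ((m * ip n r r - ip n r (app n A r)) / 2)"
      by (simp add: field_simps)
  qed
  then have "app n A x i = m * x i" if "i < n" for i
    using that by (auto simp: ip_self_eq_0 r_def)
  from that[OF x1 xv this] show ?thesis .
qed

lemma exists_orthonormal_eigenvectors:
  assumes sym: "\<And>i j. i < n \<Longrightarrow> j < n \<Longrightarrow> A i j = A j i"
    and "k \<le> n"
  shows "\<exists>v l. (\<forall>p<k. \<forall>q<k. ip n (v p) (v q) = (if p = q then 1 else 0)) \<and>
    (\<forall>p<k. \<forall>i<n. app n A (v p) i = l p * v p i)"
  using \<open>k \<le> n\<close>
proof (induction k)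
  case 0
  then show ?case by simp
next
  case (Suc k)
  then have "k \<le> n" by simp
  from Suc.IH[OF this] obtain v l
    where v: "\<forall>p<k. \<forall>q<k. ip n (v p) (v q) = (if p = q then 1 else 0)"
    and l: "\<forall>p<k. \<forall>i<n. app n A (v p) i = l p * v p i"
    by blast
  obtain x m where x: "ip n x x = 1" "\<And>p. p < k \<Longrightarrow> ip n x (v p) = 0"
    "\<And>i. i < n \<Longrightarrow> app n A x i = m * x i"
    by (rule exists_orthogonal_eigenvector[of n A k v l]) (use sym l Suc.prems in auto)
  have x': "ip n (v p) x = 0" if "p < k" for p
    using x(2)[OF that] by (simp add: ip_commute[of n "v p"])
  show ?case
    by (rule exI[of _ "v(k := x)"], rule exI[of _ "l(k := m)"])
      (use v l x x' in \<open>auto simp: less_Suc_eq\<close>)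
qed

section \<open>Spectral decompositions and eigenvalue counts\<close>

lemma order_prod_linear:
  fixes l :: "nat \<Rightarrow> real"
  assumes "finite K"
  shows "Polynomial.order x (\<Prod>k\<in>K. [:- l k, 1:]) = card {k\<in>K. l k = x}"
  using assms
proof (induction K rule: finite_induct)
  case empty
  then show ?case by simp
next
  case (insert k K)
  have "(\<Prod>k\<in>insert k K. [:- l k, 1:]) \<noteq> 0"
    using insert by (subst prod_zero_iff) auto
  then have "Polynomial.order x (\<Prod>k\<in>insert k K. [:- l k, 1:])
      = Polynomial.order x [:- l k, 1:] + card {k\<in>K. l k = x}"
    using insert by (simp only: prod.insert order_mult insert.IH not_False_eq_True)
  moreover have "{j \<in> insert k K. l j = x} =
      (if l k = x then insert k {j\<in>K. l j = x} else {j\<in>K. l j = x})" by auto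
  moreover have "Polynomial.order x [:- l k, 1:] = (if l k = x then 1 else 0)"
  proof (cases "l k = x")
    case True
    then show ?thesis using order_power_n_n[of x 1] by simp
  next
    case False
    then show ?thesis by (auto intro!: order_0I)
  qed
  ultimately show ?case using insert by simp
qed

text \<open>With the \<open>v k\<close> as rows of V and D the diagonal matrix of \<open>l\<close>,
  the clauses are V V^T = 1, V^T V = 1 and A = V^T D V.\<close>

definition spectral :: "nat \<Rightarrow> (nat \<Rightarrow> nat \<Rightarrow> real) \<Rightarrow> (nat \<Rightarrow> nat \<Rightarrow> real) \<Rightarrow> (nat \<Rightarrow> real) \<Rightarrow> bool" where
  "spectral n A v l \<longleftrightarrow>
     (\<forall>p<n. \<forall>q<n. ip n (v p) (v q) = (if p = q then 1 else 0)) \<and>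
     (\<forall>i<n. \<forall>j<n. (\<Sum>k<n. v k i * v k j) = (if i = j then 1 else 0)) \<and>
     (\<forall>i<n. \<forall>j<n. A i j = (\<Sum>k<n. l k * v k i * v k j))"

lemma spectral_exists:
  assumes sym: "\<And>i j. i < n \<Longrightarrow> j < n \<Longrightarrow> A i j = A j i"
  obtains v l where "spectral n A v l"
proof -
  obtain v l where v: "\<forall>p<n. \<forall>q<n. ip n (v p) (v q) = (if p = q then 1 else 0)"
    and l: "\<forall>p<n. \<forall>i<n. app n A (v p) i = l p * v p i"
    using exists_orthonormal_eigenvectors[where A = A, OF sym order_refl] by blast
  define V where "V = mat n n (\<lambda>(p, i). v p i)"
  have V: "V \<in> carrier_mat n n" "transpose_mat V \<in> carrier_mat n n" by (auto simp: V_def)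
  have "V * transpose_mat V = 1\<^sub>m n"
    using v by (intro eq_matI) (auto simp: V_def scalar_prod_def ip_def lessThan_atLeast0)
  \<comment> \<open>For a square matrix, orthonormal rows imply orthonormal columns; this
    completeness relation is then inserted into \<open>A\<close>.\<close>
  then have "transpose_mat V * V = 1\<^sub>m n"
    using mat_mult_left_right_inverse[OF V] by blast
  then have e: "(transpose_mat V * V) $$ (i, j) = 1\<^sub>m n $$ (i, j)" for i j by simp
  have c: "(\<Sum>k<n. v k i * v k j) = (if i = j then 1 else 0)" if "i < n" "j < n" for i j
    using e[of i j] that by (simp add: V_def scalar_prod_def lessThan_atLeast0)
  have "A i j = (\<Sum>k<n. l k * v k i * v k j)" if "i < n" "j < n" for i j
  proof -
    have "(\<Sum>k<n. l k * v k i * v k j) = (\<Sum>k<n. app n A (v k) i * v k j)"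
      using l that by (intro sum.cong) auto
    also have "\<dots> = (\<Sum>k<n. \<Sum>m<n. A i m * (v k m * v k j))"
      by (simp add: app_def sum_distrib_right mult.assoc)
    also have "\<dots> = (\<Sum>m<n. A i m * (\<Sum>k<n. v k m * v k j))"
      by (subst sum.swap) (simp add: sum_distrib_left)
    also have "\<dots> = (\<Sum>m<n. if m = j then A i m else 0)"
      using that by (intro sum.cong) (auto simp: c)
    also have "\<dots> = A i j" using that by simp
    finally show ?thesis by simp
  qed
  then have "spectral n A v l" using v c by (auto simp: spectral_def)
  then show ?thesis by (rule that)
qed

lemma spectral_uminus:
  assumes "spectral n A v l"
  shows "spectral n (\<lambda>i j. - A i j) v (\<lambda>k. - l k)"
  using assms by (auto simp: spectral_def sum_negf)

text \<open>\<open>M\<close> is similar to the diagonal matrix of \<open>l\<close>, so its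
  characteristic polynomial is the product of the factors X - \<open>l k\<close>. Algebraic
  multiplicities thereby become numbers of indices.\<close>

lemma eigenvalue_count_spectral:
  assumes M: "M \<in> carrier_mat n n" and s: "spectral n (\<lambda>i j. M $$ (i, j)) v l"
  shows "eigenvalue_count M S = card {k\<in>{..<n}. l k \<in> S}"
proof -
  define V where "V = mat n n (\<lambda>(p, i). v p i)"
  define D where "D = mat n n (\<lambda>(p, q). if p = q then l p else 0)"
  have V: "V \<in> carrier_mat n n" "transpose_mat V \<in> carrier_mat n n" by (auto simp: V_def)
  have D: "D \<in> carrier_mat n n" by (simp add: D_def)
  have 1: "V * transpose_mat V = 1\<^sub>m n"
    using s by (intro eq_matI) (auto simp: spectral_def V_def scalar_prod_def ip_def lessThan_atLeast0)
  then have 2: "transpose_mat V * V = 1\<^sub>m n"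
    using mat_mult_left_right_inverse[OF V] by blast
  have "M = transpose_mat V * D * V"
  proof (rule eq_matI)
    fix i j assume "i < dim_row (transpose_mat V * D * V)" "j < dim_col (transpose_mat V * D * V)"
    then have ij: "i < n" "j < n" by (auto simp: V_def)
    have "(transpose_mat V * D) $$ (i, k) = l k * v k i" if "k < n" for k
      using ij that by (simp add: V_def D_def scalar_prod_def if_distrib[of "(*) _"] cong: if_cong)
    then have "(transpose_mat V * D * V) $$ (i, j) = (\<Sum>k<n. l k * v k i * v k j)"
      using ij by (simp add: V_def D_def scalar_prod_def lessThan_atLeast0)
    then show "M $$ (i, j) = (transpose_mat V * D * V) $$ (i, j)"
      using s ij by (simp add: spectral_def)
  qed (use M V in auto)
  then have "similar_mat_wit M D (transpose_mat V) V"
    unfolding similar_mat_wit_def using M D V 1 2 by (auto simp: Let_def)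
  then have "similar_mat M D" unfolding similar_mat_def by blast
  then have "char_poly M = char_poly D" by (rule char_poly_similar)
  also have "\<dots> = (\<Prod>a\<leftarrow>diag_mat D. [:- a, 1:])"
    by (rule char_poly_upper_triangular[OF D]) (auto simp: D_def upper_triangular_def)
  also have "\<dots> = (\<Prod>k\<in>{..<n}. [:- l k, 1:])"
    by (simp add: diag_mat_def D_def comp_def prod.list_conv_set_nth lessThan_atLeast0)
  finally have cp: "char_poly M = (\<Prod>k\<in>{..<n}. [:- l k, 1:])" .
  have ev: "eigenvalue M x \<longleftrightarrow> (\<exists>k<n. l k = x)" for x
    by (auto simp: eigenvalue_root_char_poly[OF M] cp poly_prod prod_zero_iff)
  have "eigenvalue_count M S = (\<Sum>x\<in>l ` {..<n} \<inter> S. card {k\<in>{..<n}. l k = x})"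
    unfolding eigenvalue_count_def ev cp order_prod_linear[OF finite_lessThan]
    by (rule sum.cong) auto
  also have "\<dots> = card (\<Union>x\<in>l ` {..<n} \<inter> S. {k\<in>{..<n}. l k = x})"
    by (rule card_UN_disjoint[symmetric]) auto
  also have "(\<Union>x\<in>l ` {..<n} \<inter> S. {k\<in>{..<n}. l k = x}) = {k\<in>{..<n}. l k \<in> S}" by auto
  finally show ?thesis .
qed

section \<open>Positive index of a quadratic form\<close>

definition qf :: "nat \<Rightarrow> (nat \<Rightarrow> nat \<Rightarrow> real) \<Rightarrow> (nat \<Rightarrow> real) \<Rightarrow> real" where
  "qf n A x = ip n x (app n A x)"

text \<open>Expansions in the eigenbasis; the third is Parseval's identity.\<close>

lemma
  assumes s: "spectral n A v l"
  shows spectral_app: "i < n \<Longrightarrow> app n A x i = (\<Sum>k<n. l k * ip n x (v k) * v k i)"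
    and spectral_qf: "qf n A x = (\<Sum>k<n. l k * (ip n x (v k))\<^sup>2)"
    and spectral_norm: "ip n x x = (\<Sum>k<n. (ip n x (v k))\<^sup>2)"
proof -
  have app: "app n A x i = (\<Sum>k<n. l k * ip n x (v k) * v k i)" if "i < n" for i x
  proof -
    have "app n A x i = (\<Sum>j<n. \<Sum>k<n. l k * v k i * v k j * x j)"
      using s that by (auto simp: app_def spectral_def sum_distrib_right intro!: sum.cong)
    also have "\<dots> = (\<Sum>k<n. l k * ip n x (v k) * v k i)"
      by (subst sum.swap) (simp add: ip_def sum_distrib_left sum_distrib_right mult_ac)
    finally show ?thesis .
  qed
  then show "i < n \<Longrightarrow> app n A x i = (\<Sum>k<n. l k * ip n x (v k) * v k i)" .
  \<comment> \<open>Kept general in \<open>m\<close>: taking \<open>l\<close> gives the quadratic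
    form, the constant 1 gives the norm.\<close>
  have sw: "(\<Sum>i<n. x i * (\<Sum>k<n. m k * ip n x (v k) * v k i)) = (\<Sum>k<n. m k * (ip n x (v k))\<^sup>2)" for m
  proof -
    have "(\<Sum>i<n. x i * (\<Sum>k<n. m k * ip n x (v k) * v k i))
      = (\<Sum>k<n. \<Sum>i<n. m k * ip n x (v k) * (x i * v k i))"
      by (subst sum.swap) (simp add: sum_distrib_left mult_ac)
    also have "\<dots> = (\<Sum>k<n. m k * ip n x (v k) * ip n x (v k))"
      by (simp add: sum_distrib_left[symmetric] ip_def)
    finally show ?thesis by (simp add: power2_eq_square mult.assoc)
  qed
  show "qf n A x = (\<Sum>k<n. l k * (ip n x (v k))\<^sup>2)"
    unfolding qf_def ip_def[of n x "app n A x"] sw[symmetric] by (rule sum.cong) (auto simp: app)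
  have x: "(\<Sum>k<n. 1 * ip n x (v k) * v k i) = x i" if "i < n" for i
  proof -
    have "(\<Sum>k<n. 1 * ip n x (v k) * v k i) = (\<Sum>k<n. \<Sum>j<n. x j * (v k j * v k i))"
      by (simp add: ip_def sum_distrib_right mult.assoc)
    also have "\<dots> = (\<Sum>j<n. x j * (\<Sum>k<n. v k j * v k i))"
      by (subst sum.swap) (simp add: sum_distrib_left)
    also have "\<dots> = (\<Sum>j<n. if j = i then x j else 0)"
      using s that by (intro sum.cong) (auto simp: spectral_def)
    finally show ?thesis using that by simp
  qed
  show "ip n x x = (\<Sum>k<n. (ip n x (v k))\<^sup>2)"
    using sw[of "\<lambda>_. 1"] x by (simp add: ip_def[of n x x])
qed

lemma spectral_orthonormal:
  assumes "spectral n A v l" "p < n" "q < n"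
  shows "ip n (v p) (v q) = (if p = q then 1 else 0)"
  using assms by (simp add: spectral_def)

lemma spectral_ip_combination:
  assumes s: "spectral n A v l" and "J \<subseteq> {..<n}" "k < n"
  shows "ip n (\<lambda>i. \<Sum>j\<in>J. c j * v j i) (v k) = (if k \<in> J then c k else 0)"
proof -
  have "ip n (\<lambda>i. \<Sum>j\<in>J. c j * v j i) (v k) = (\<Sum>j\<in>J. if j = k then c j else 0)"
    unfolding ip_sum_left using assms
    by (intro sum.cong) (auto simp: spectral_orthonormal[OF s] subset_iff)
  then show ?thesis using finite_subset[OF \<open>J \<subseteq> {..<n}\<close>] by simp
qed

text \<open>Half of the variational description of the positive index. A family larger than the
  number of positive eigenvalues has a nontrivial combination orthogonal to all positive
  eigenvectors, where the form is at most 0. Positivity for all nonzero coefficients contains the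
  linear independence of \<open>w\<close>.\<close>

lemma card_le_positive_index:
  assumes s: "spectral n A v l" and "finite J"
    and pos: "\<And>c. \<exists>j\<in>J. c j \<noteq> 0 \<Longrightarrow> qf n A (\<lambda>i. \<Sum>j\<in>J. c j * w j i) > 0"
  shows "card J \<le> card {k\<in>{..<n}. l k > 0}"
proof (rule ccontr)
  assume "\<not> ?thesis"
  then have "card {k\<in>{..<n}. l k > 0} < card J" by simp
  with \<open>finite J\<close> obtain c where c: "\<exists>j\<in>J. c j \<noteq> 0"
    "\<And>k. k \<in> {k\<in>{..<n}. l k > 0} \<Longrightarrow> (\<Sum>j\<in>J. ip n (w j) (v k) * c j) = 0"
    using underdetermined_system[of "{k\<in>{..<n}. l k > 0}" J "\<lambda>k j. ip n (w j) (v k)"] by auto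
  define x where "x = (\<lambda>i. \<Sum>j\<in>J. c j * w j i)"
  have "ip n x (v k) = 0" if "k < n" "l k > 0" for k
    using c(2)[of k] that by (simp add: x_def ip_sum_left mult.commute)
  then have "l k * (ip n x (v k))\<^sup>2 \<le> 0" if "k < n" for k
    using that by (cases "l k > 0") (auto simp: mult_nonpos_nonneg)
  then have "qf n A x \<le> 0" unfolding spectral_qf[OF s] by (intro sum_nonpos) auto
  with pos[OF c(1)] show False by (simp add: x_def)
qed

section \<open>Kernels in terms of eigenvectors\<close>

lemma spectral_kernel_combination:
  assumes s: "spectral n A v l" and "J \<subseteq> {k\<in>{..<n}. l k = 0}" "i < n"
  shows "app n A (\<lambda>i. \<Sum>j\<in>J. c j * v j i) i = 0"
  unfolding spectral_app[OF s \<open>i < n\<close>]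
proof (intro sum.neutral ballI)
  fix k assume "k \<in> {..<n}"
  moreover have "J \<subseteq> {..<n}" using assms(2) by auto
  ultimately have "ip n (\<lambda>i. \<Sum>j\<in>J. c j * v j i) (v k) = (if k \<in> J then c k else 0)"
    using spectral_ip_combination[OF s] by auto
  then show "l k * ip n (\<lambda>i. \<Sum>j\<in>J. c j * v j i) (v k) * v k i = 0"
    using assms(2) by auto
qed

text \<open>A kernel vector has no component at nonzero eigenvalues, and \<open>orth\<close> removes
  the remaining ones; Parseval then gives 0.\<close>

lemma spectral_kernel_orthogonal:
  assumes s: "spectral n A v l"
    and w: "\<And>i. i < n \<Longrightarrow> app n A w i = 0"
    and orth: "\<And>k. k < n \<Longrightarrow> l k = 0 \<Longrightarrow> ip n w (v k) = 0"
    and "i < n"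
  shows "w i = 0"
proof -
  have "ip n w (v k) = 0" if "k < n" for k
  proof (cases "l k = 0")
    case False
    have "l k * ip n w (v k) = ip n (\<lambda>i. \<Sum>j<n. (l j * ip n w (v j)) * v j i) (v k)"
      using spectral_ip_combination[OF s order_refl, of k "\<lambda>j. l j * ip n w (v j)"] that by simp
    also have "\<dots> = ip n (\<lambda>_. 0) (v k)"
      by (rule ip_cong) (use w in \<open>auto simp: spectral_app[OF s]\<close>)
    finally show ?thesis using False by (simp add: ip_def)
  qed (use orth that in auto)
  then have "ip n w w = 0" by (simp add: spectral_norm[OF s])
  with \<open>i < n\<close> show ?thesis by (simp add: ip_self_eq_0)
qed

text \<open>The unknowns are the coordinates of \<open>y\<close> and \<open>x - y\<close> in the two kernels and a scaling
  factor for \<open>x\<close>; the equations are the \<open>n\<close> coordinates and orthogonality of \<open>y\<close> to the kernel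
  of \<open>A\<close>. The latter forces the scaling factor of a nontrivial solution to be nonzero.\<close>
lemma kernel_decomposition:
  assumes s: "spectral n A v l" and s1: "spectral n A1 v1 l1" and s2: "spectral n A2 v2 l2"
    and common: "\<And>w. (\<And>i. i < n \<Longrightarrow> app n A1 w i = 0) \<Longrightarrow> (\<And>i. i < n \<Longrightarrow> app n A2 w i = 0) \<Longrightarrow>
      (\<And>i. i < n \<Longrightarrow> app n A w i = 0)"
    and dim: "n + card {k\<in>{..<n}. l k = 0} \<le>
      card {k\<in>{..<n}. l1 k = 0} + card {k\<in>{..<n}. l2 k = 0}"
  obtains y where "\<And>i. i < n \<Longrightarrow> app n A1 y i = 0"
    "\<And>i. i < n \<Longrightarrow> app n A2 (\<lambda>i. x i - y i) i = 0"
proof -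
  define Z where "Z = {k\<in>{..<n}. l k = 0}"
  define Z1 where "Z1 = {k\<in>{..<n}. l1 k = 0}"
  define Z2 where "Z2 = {k\<in>{..<n}. l2 k = 0}"
  have fin: "finite Z" "finite Z1" "finite Z2" by (simp_all add: Z_def Z1_def Z2_def)
  define F :: "nat + nat \<Rightarrow> nat + nat + unit \<Rightarrow> real" where
    "F = case_sum
      (\<lambda>i. case_sum (\<lambda>j. v1 j i) (case_sum (\<lambda>j. v2 j i) (\<lambda>_. - x i)))
      (\<lambda>k. case_sum (\<lambda>j. ip n (v1 j) (v k)) (\<lambda>_. 0))"
  \<comment> \<open>The unknown indexed by \<open>unit\<close>, the scaling factor of
    \<open>x\<close>, makes the inequality strict.\<close>
  have "card ({..<n} <+> Z) < card (Z1 <+> Z2 <+> {()})"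
    using dim fin by (simp add: card_Plus Z_def Z1_def Z2_def)
  with fin obtain c where nz: "\<exists>j\<in>Z1 <+> Z2 <+> {()}. c j \<noteq> 0"
    and c: "\<And>i. i \<in> {..<n} <+> Z \<Longrightarrow> (\<Sum>j\<in>Z1 <+> Z2 <+> {()}. F i j * c j) = 0"
    using underdetermined_system[of "{..<n} <+> Z" "Z1 <+> Z2 <+> {()}" F] by auto
  define c1 where "c1 = (\<lambda>j. c (Inl j))"
  define c2 where "c2 = (\<lambda>j. c (Inr (Inl j)))"
  define t where "t = c (Inr (Inr ()))"
  define y where "y = (\<lambda>i. \<Sum>j\<in>Z1. c1 j * v1 j i)"
  define z where "z = (\<lambda>i. \<Sum>j\<in>Z2. c2 j * v2 j i)"
  have yz: "y i + z i = t * x i" if "i < n" for i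
    using c[of "Inl i"] that fin
    by (simp add: F_def sum.Plus y_def z_def c1_def c2_def t_def mult.commute InlI)
  have orth: "ip n y (v k) = 0" if "k \<in> Z" for k
    using c[of "Inr k"] that fin
    by (simp add: F_def sum.Plus y_def c1_def ip_sum_left mult.commute InrI)
  have ky: "app n A1 y i = 0" if "i < n" for i
    unfolding y_def using spectral_kernel_combination[OF s1 _ that] by (simp add: Z1_def)
  have kz: "app n A2 z i = 0" if "i < n" for i
    unfolding z_def using spectral_kernel_combination[OF s2 _ that] by (simp add: Z2_def)
  \<comment> \<open>Otherwise \<open>z = - y\<close>, so \<open>y\<close> lies in both kernels,
    hence in that of \<open>A\<close>, to which it is orthogonal. Then \<open>y\<close> and
    \<open>z\<close> vanish, and with them all coefficients.\<close>
  have "t \<noteq> 0"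
  proof
    assume "t = 0"
    then have z: "z i = - y i" if "i < n" for i using yz[OF that] by simp
    have "app n A2 y i = - app n A2 z i" for i by (simp add: app_def z sum_negf)
    then have "app n A2 y i = 0" if "i < n" for i using kz[OF that] by simp
    then have "app n A y i = 0" if "i < n" for i using common[of y] ky that by blast
    then have y0: "y i = 0" if "i < n" for i
      using spectral_kernel_orthogonal[OF s _ _ that, of y] orth by (simp add: Z_def)
    then have z0: "z i = 0" if "i < n" for i using z that by simp
    have "c1 k = 0" if "k \<in> Z1" for k
    proof -
      have "c1 k = ip n y (v1 k)"
        unfolding y_def using that
        by (subst spectral_ip_combination[OF s1, of Z1]) (auto simp: Z1_def)
      then show ?thesis by (simp add: ip_def y0)
    qed
    moreover have "c2 k = 0" if "k \<in> Z2" for k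
    proof -
      have "c2 k = ip n z (v2 k)"
        unfolding z_def using that
        by (subst spectral_ip_combination[OF s2, of Z2]) (auto simp: Z2_def)
      then show ?thesis by (simp add: ip_def z0)
    qed
    ultimately show False using nz \<open>t = 0\<close> by (auto simp: c1_def c2_def t_def)
  qed
  have "app n A1 (\<lambda>i. 1 / t * y i) i = 0" if "i < n" for i
    using ky[OF that] unfolding app_scale by simp
  moreover have "app n A2 (\<lambda>i. x i - 1 / t * y i) i = 0" if "i < n" for i
  proof -
    have "app n A2 (\<lambda>i. x i - 1 / t * y i) i = app n A2 (\<lambda>i. 1 / t * z i) i"
    proof -
      have "x j - 1 / t * y j = 1 / t * z j" if "j < n" for j
        using yz[OF that] \<open>t \<noteq> 0\<close> by (simp add: field_simps)
      then show ?thesis by (simp add: app_def)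
    qed
    then show ?thesis using kz[OF that] unfolding app_scale by simp
  qed
  ultimately show ?thesis by (rule that)
qed

section \<open>Stability of the positive index under small perturbations\<close>

lemma qf_add_scale: "qf n (\<lambda>i j. A i j + s * B i j) x = qf n A x + s * qf n B x"
proof -
  have "app n (\<lambda>i j. A i j + s * B i j) x = (\<lambda>i. app n A x i + s * app n B x i)"
    by (simp add: app_def distrib_right sum.distrib sum_distrib_left mult.assoc)
  then show ?thesis by (simp add: qf_def ip_add_right ip_scale_right)
qed

text \<open>On the span of the positive eigenvectors of \<open>A\<close>, the form of
  \<open>A\<close> is at least \<open>m\<close> times the squared norm, that of \<open>B\<close> at
  least \<open>- C\<close> times it. A positive \<open>t\<close> with \<open>t * C < m\<close> keeps
  the perturbed form positive definite there.\<close>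

lemma positive_index_lower_semicontinuous:
  assumes s: "spectral n A v l"
    and symB: "\<And>i j. i < n \<Longrightarrow> j < n \<Longrightarrow> B i j = B j i"
  shows "\<exists>t>0. \<forall>v' l'. spectral n (\<lambda>i j. A i j + t * B i j) v' l' \<longrightarrow>
    card {k\<in>{..<n}. l k > 0} \<le> card {k\<in>{..<n}. l' k > 0}"
proof -
  define J where "J = {k\<in>{..<n}. l k > 0}"
  have J: "finite J" "J \<subseteq> {..<n}" by (auto simp: J_def)
  \<comment> \<open>The inserted 1 keeps the minimum defined and positive when \<open>A\<close> has
    no positive eigenvalue.\<close>
  define m where "m = Min (insert 1 (l ` J))"
  have m: "m > 0" "\<And>k. k \<in> J \<Longrightarrow> m \<le> l k" using J by (auto simp: m_def) (auto simp: J_def)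
  obtain w b where sB: "spectral n B w b" using spectral_exists[of n B] symB by blast
  define C where "C = (\<Sum>k<n. \<bar>b k\<bar>)"
  have C: "C \<ge> 0" "\<And>k. k < n \<Longrightarrow> \<bar>b k\<bar> \<le> C"
    unfolding C_def by (auto intro: sum_nonneg member_le_sum)
  define t where "t = m / (C + 1)"
  have t: "t > 0" "t * C < m" using m C by (auto simp: t_def field_simps)
  have "card J \<le> card {k\<in>{..<n}. l' k > 0}"
    if s': "spectral n (\<lambda>i j. A i j + t * B i j) v' l'" for v' l'
  proof (rule card_le_positive_index[OF s' J(1)])
    fix c :: "nat \<Rightarrow> real" assume nz: "\<exists>j\<in>J. c j \<noteq> 0"
    define x where "x = (\<lambda>i. \<Sum>j\<in>J. c j * v j i)"
    have ipx: "ip n x (v k) = (if k \<in> J then c k else 0)" if "k < n" for k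
      using spectral_ip_combination[OF s J(2) that] by (simp add: x_def)
    have nx: "ip n x x > 0"
    proof -
      obtain j where "j \<in> J" "c j \<noteq> 0" using nz by blast
      moreover from this have "j < n" using J by auto
      ultimately have "(\<Sum>k<n. (ip n x (v k))\<^sup>2) > 0"
        by (intro sum_pos2[of _ j]) (auto simp: ipx)
      then show ?thesis by (simp add: spectral_norm[OF s])
    qed
    have "m * ip n x x \<le> qf n A x"
      unfolding spectral_norm[OF s] spectral_qf[OF s] sum_distrib_left
      by (rule sum_mono) (auto simp: ipx m mult_right_mono)
    moreover have "- C * ip n x x \<le> qf n B x"
      unfolding spectral_norm[OF sB] spectral_qf[OF sB] sum_distrib_left
      by (intro sum_mono mult_right_mono) (use C in \<open>force simp: abs_le_iff\<close>)+
    then have "t * (- C * ip n x x) \<le> t * qf n B x" using t by (intro mult_left_mono) auto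
    ultimately have "(m - t * C) * ip n x x \<le> qf n (\<lambda>i j. A i j + t * B i j) x"
      by (simp add: qf_add_scale algebra_simps)
    then show "0 < qf n (\<lambda>i j. A i j + t * B i j) (\<lambda>i. \<Sum>j\<in>J. c j * v j i)"
      using t nx by (simp add: x_def[symmetric]) (meson diff_gt_0_iff_gt less_le_trans mult_pos_pos)
  qed
  with t show ?thesis by (auto simp: J_def)
qed

section \<open>Weighted Laplacian forms\<close>

text \<open>For \<open>i < n\<close> an entry \<open>a i i\<close> occurs with both signs and
  cancels, so loops contribute nothing.\<close>

definition lap :: "nat \<Rightarrow> (nat \<Rightarrow> nat \<Rightarrow> real) \<Rightarrow> nat \<Rightarrow> nat \<Rightarrow> real" where
  "lap n a i j = a i j - (if i = j then \<Sum>k<n. a i k else 0)"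

lemma lap_uminus: "lap n (\<lambda>i j. - a i j) = (\<lambda>i j. - lap n a i j)"
  by (auto simp: lap_def sum_negf fun_eq_iff)

lemma lap_add_scale:
  "lap n (\<lambda>i j. a i j + s * b i j) = (\<lambda>i j. lap n a i j + s * lap n b i j)"
  by (auto simp: lap_def sum.distrib sum_distrib_left algebra_simps fun_eq_iff)

lemma lap_symmetric: "(\<And>i j. a i j = a j i) \<Longrightarrow> lap n a i j = lap n a j i"
  by (auto simp: lap_def)

lemma lap_spectral_exists:
  assumes "\<And>i j. a i j = a j i"
  obtains v l where "spectral n (lap n a) v l"
  using spectral_exists[of n "lap n a"] lap_symmetric[of a n, OF assms] by blast

lemma app_lap: "i < n \<Longrightarrow> app n (lap n a) x i = (\<Sum>j<n. a i j * (x j - x i))"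
proof -
  assume i: "i < n"
  have "app n (lap n a) x i = (\<Sum>j<n. a i j * x j - (if i = j then (\<Sum>k<n. a i k) * x j else 0))"
    by (auto simp: app_def lap_def algebra_simps intro!: sum.cong)
  then show ?thesis
    using i by (simp add: sum_subtractf right_diff_distrib sum_distrib_right)
qed

text \<open>Exchanging the summation indices gives a second expression for the form; the two add up
  to minus the sum of squares.\<close>

lemma qf_lap:
  assumes "\<And>i j. a i j = a j i"
  shows "qf n (lap n a) x = - (\<Sum>i<n. \<Sum>j<n. a i j * (x i - x j)\<^sup>2) / 2"
proof -
  have 1: "qf n (lap n a) x = (\<Sum>i<n. \<Sum>j<n. a i j * (x j - x i) * x i)"
    by (simp add: qf_def ip_def app_lap sum_distrib_left mult_ac)
  also have "\<dots> = (\<Sum>i<n. \<Sum>j<n. a i j * (x i - x j) * x j)"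
    using assms by (subst sum.swap) auto
  finally have 2: "qf n (lap n a) x = (\<Sum>i<n. \<Sum>j<n. a i j * (x i - x j) * x j)" .
  have "2 * qf n (lap n a) x = (\<Sum>i<n. \<Sum>j<n. a i j * (x j - x i) * x i + a i j * (x i - x j) * x j)"
    unfolding sum.distrib using 1 2 by simp
  also have "\<dots> = - (\<Sum>i<n. \<Sum>j<n. a i j * (x i - x j)\<^sup>2)"
    unfolding sum_negf[symmetric]
    by (intro sum.cong refl) (simp add: power2_eq_square algebra_simps)
  finally show ?thesis by simp
qed

text \<open>For nonnegative weights the form is, up to a negative factor, a sum of nonnegative
  terms; a kernel vector makes each of them vanish.\<close>

lemma lap_kernel_constant:
  assumes sym: "\<And>i j. a i j = a j i" and nonneg: "\<And>i j. a i j \<ge> 0"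
    and ker: "\<And>i. i < n \<Longrightarrow> app n (lap n a) x i = 0"
    and "i < n" "j < n" "a i j \<noteq> 0"
  shows "x i = x j"
proof -
  have "qf n (lap n a) x = 0" by (simp add: qf_def ip_def ker)
  then have "(\<Sum>i<n. \<Sum>j<n. a i j * (x i - x j)\<^sup>2) = 0" by (simp add: qf_lap[OF sym])
  then have "a i j * (x i - x j)\<^sup>2 = 0"
    using assms by (auto simp: sum_nonneg_eq_0_iff sum_nonneg)
  then show ?thesis using assms by simp
qed

text \<open>The splitting is encoded by \<open>z\<close> alone: the second clause makes
  \<open>x - z\<close> constant along negative edges.\<close>

definition separates_signs :: "nat \<Rightarrow> (nat \<Rightarrow> nat \<Rightarrow> real) \<Rightarrow> bool" where
  "separates_signs n a \<longleftrightarrow> (\<forall>x::nat \<Rightarrow> real. \<exists>z::nat \<Rightarrow> real. \<forall>i<n. \<forall>j<n.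
     (a i j > 0 \<longrightarrow> z i = z j) \<and> (a i j < 0 \<longrightarrow> z i - z j = x i - x j))"

text \<open>Negation exchanges the roles of \<open>z\<close> and \<open>x - z\<close>.\<close>

lemma separates_signs_uminus:
  assumes "separates_signs n a"
  shows "separates_signs n (\<lambda>i j. - a i j)"
  unfolding separates_signs_def
proof
  fix x :: "nat \<Rightarrow> real"
  from assms obtain z where z: "\<forall>i<n. \<forall>j<n.
     (a i j > 0 \<longrightarrow> z i = z j) \<and> (a i j < 0 \<longrightarrow> z i - z j = x i - x j)"
    unfolding separates_signs_def by blast
  then show "\<exists>z. \<forall>i<n. \<forall>j<n. (- a i j > 0 \<longrightarrow> z i = z j) \<and> (- a i j < 0 \<longrightarrow> z i - z j = x i - x j)"
    by (intro exI[of _ "\<lambda>i. x i - z i"]) (auto simp: algebra_simps)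
qed

text \<open>At the \<open>z\<close>-part of a vector, positive edges drop out of the form and
  negative ones contribute nonnegatively, whatever the sizes of the weights. So positivity of the
  form of \<open>a\<close> at \<open>x\<close> carries over to that of \<open>b\<close> at
  \<open>z\<close>.\<close>

lemma positive_index_le:
  assumes sep: "separates_signs n a"
    and sym: "\<And>i j. a i j = a j i" "\<And>i j. b i j = b j i"
    and sgn: "\<And>i j. i < n \<Longrightarrow> j < n \<Longrightarrow> sgn (a i j) = sgn (b i j)"
    and s: "spectral n (lap n a) v l" and s': "spectral n (lap n b) v' l'"
  shows "card {k\<in>{..<n}. l k > 0} \<le> card {k\<in>{..<n}. l' k > 0}"
proof -
  \<comment> \<open>A part \<open>w k\<close> is fixed for every \<open>v k\<close>; the conditions
    are linear, so combinations of the \<open>w k\<close> split the same combinations of the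
    \<open>v k\<close>.\<close>
  define J where "J = {k\<in>{..<n}. l k > 0}"
  have J: "finite J" "J \<subseteq> {..<n}" by (auto simp: J_def)
  obtain w where w: "\<And>k i j. i < n \<Longrightarrow> j < n \<Longrightarrow> a i j > 0 \<Longrightarrow> w k i = w k j"
    "\<And>k i j. i < n \<Longrightarrow> j < n \<Longrightarrow> a i j < 0 \<Longrightarrow> w k i - w k j = v k i - v k j"
  proof -
    have "\<forall>k. \<exists>z. \<forall>i<n. \<forall>j<n. (a i j > 0 \<longrightarrow> z i = z j) \<and> (a i j < 0 \<longrightarrow> z i - z j = v k i - v k j)"
      using sep unfolding separates_signs_def by blast
    from choice[OF this] show ?thesis using that by blast
  qed
  have "card J \<le> card {k\<in>{..<n}. l' k > 0}"
  proof (rule card_le_positive_index[OF s' J(1)])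
    fix c :: "nat \<Rightarrow> real" assume nz: "\<exists>j\<in>J. c j \<noteq> 0"
    define x where "x = (\<lambda>i. \<Sum>j\<in>J. c j * v j i)"
    define z where "z = (\<lambda>i. \<Sum>j\<in>J. c j * w j i)"
    have z: "a i j > 0 \<Longrightarrow> z i = z j" "a i j < 0 \<Longrightarrow> z i - z j = x i - x j" if "i < n" "j < n" for i j
      using w that by (auto simp: z_def x_def sum_subtractf[symmetric] right_diff_distrib[symmetric])
    have "qf n (lap n a) x > 0"
    proof -
      obtain j where j: "j \<in> J" "c j \<noteq> 0" using nz by blast
      have "0 < (\<Sum>k<n. l k * (ip n x (v k))\<^sup>2)"
      proof (rule sum_pos2[of _ j])
        show "0 < l j * (ip n x (v j))\<^sup>2"
          using j spectral_ip_combination[OF s J(2), of j c] by (auto simp: x_def J_def)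
        show "0 \<le> l k * (ip n x (v k))\<^sup>2" if "k \<in> {..<n}" for k
          using that spectral_ip_combination[OF s J(2), of k c] by (auto simp: x_def J_def)
      qed (use j J in auto)
      then show ?thesis by (simp add: spectral_qf[OF s])
    qed
    then have neg: "(\<Sum>i<n. \<Sum>j<n. a i j * (x i - x j)\<^sup>2) < 0" by (simp add: qf_lap[OF sym(1)])
    \<comment> \<open>Positivity at \<open>x\<close> requires a negative edge across which
      \<open>x\<close> varies; this edge makes the form of \<open>b\<close> at \<open>z\<close>
      strictly positive.\<close>
    have "\<exists>i<n. \<exists>j<n. a i j * (x i - x j)\<^sup>2 < 0"
    proof (rule ccontr)
      assume "\<not> ?thesis"
      then have "(\<Sum>i<n. \<Sum>j<n. a i j * (x i - x j)\<^sup>2) \<ge> 0"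
        by (intro sum_nonneg) force
      with neg show False by simp
    qed
    then obtain i j where ij: "i < n" "j < n" "a i j * (x i - x j)\<^sup>2 < 0" by blast
    then have aij: "a i j < 0" "x i - x j \<noteq> 0" by (auto simp: mult_less_0_iff)
    have b: "b i j * (z i - z j)\<^sup>2 \<le> 0" if "i < n" "j < n" for i j
      using z[OF that] sgn[OF that]
      by (cases "a i j > 0") (auto simp: sgn_if mult_nonpos_nonneg split: if_splits)
    have "b i j * (z i - z j)\<^sup>2 < 0"
      using z[OF ij(1,2)] sgn[OF ij(1,2)] aij by (auto simp: sgn_if mult_less_0_iff split: if_splits)
    then have "(\<Sum>j<n. - (b i j * (z i - z j)\<^sup>2)) > 0"
      using ij b by (intro sum_pos2[of _ j]) auto
    then have "(\<Sum>i<n. \<Sum>j<n. - (b i j * (z i - z j)\<^sup>2)) > 0"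
      by (rule sum_pos2[of _ i, rotated 2]) (use ij b in \<open>auto intro!: sum_nonneg simp del: sum_negf\<close>)
    then show "0 < qf n (lap n b) (\<lambda>i. \<Sum>j\<in>J. c j * w j i)"
      by (simp add: qf_lap[OF sym(2)] sum_negf z_def)
  qed
  then show ?thesis by (simp add: J_def)
qed

section \<open>Constant inertia forces splittings\<close>

lemma card_sign_partition:
  fixes l :: "nat \<Rightarrow> real"
  shows "card {k\<in>{..<n}. l k > 0} + card {k\<in>{..<n}. l k < 0} + card {k\<in>{..<n}. l k = 0} = n"
proof -
  have "card {k\<in>{..<n}. l k > 0} + card {k\<in>{..<n}. l k < 0} + card {k\<in>{..<n}. l k = 0}
    = card ({k\<in>{..<n}. l k > 0} \<union> {k\<in>{..<n}. l k < 0} \<union> {k\<in>{..<n}. l k = 0})"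
    by (subst card_Un_disjoint; auto)+
  also have "{k\<in>{..<n}. l k > 0} \<union> {k\<in>{..<n}. l k < 0} \<union> {k\<in>{..<n}. l k = 0} = {..<n}" by auto
  finally show ?thesis by simp
qed

text \<open>The eigenvalue is the value of the form at its unit eigenvector, which
  \<open>qf_lap\<close> shows to be nonpositive.\<close>

lemma lap_eigenvalue_nonpos:
  assumes sym: "\<And>i j. a i j = a j i" and nonneg: "\<And>i j. a i j \<ge> 0"
    and s: "spectral n (lap n a) v l" and "k < n"
  shows "l k \<le> 0"
proof -
  have "qf n (lap n a) (v k) = (\<Sum>j<n. if j = k then l j else 0)"
    unfolding spectral_qf[OF s] using \<open>k < n\<close>
    by (intro sum.cong) (auto simp: spectral_orthonormal[OF s])
  then have "l k = qf n (lap n a) (v k)" using \<open>k < n\<close> by simp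
  also have "\<dots> \<le> 0" by (simp add: qf_lap[OF sym] sum_nonneg nonneg)
  finally show ?thesis .
qed

text \<open>Since \<open>const\<close> covers all symmetric \<open>b\<close> with the sign pattern
  of \<open>a\<close>, the weights of one sign can be scaled towards 0.\<close>

lemma separates_signs_if_constant_inertia:
  assumes sym: "\<And>i j. a i j = a j i"
    and s: "spectral n (lap n a) v l"
    and const: "\<And>b v' l'. (\<And>i j. b i j = b j i) \<Longrightarrow> (\<And>i j. sgn (b i j) = sgn (a i j)) \<Longrightarrow>
      spectral n (lap n b) v' l' \<Longrightarrow>
      card {k\<in>{..<n}. l' k > 0} = card {k\<in>{..<n}. l k > 0} \<and>
      card {k\<in>{..<n}. l' k < 0} = card {k\<in>{..<n}. l k < 0}"
  shows "separates_signs n a"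
  unfolding separates_signs_def
proof
  fix x :: "nat \<Rightarrow> real"
  define P where "P = (\<lambda>i j. max (a i j) 0)"
  define N where "N = (\<lambda>i j. max (- a i j) 0)"
  have symPN: "P i j = P j i" "N i j = N j i" for i j by (simp_all add: P_def N_def sym[of i j])
  have nn: "P i j \<ge> 0" "N i j \<ge> 0" for i j by (simp_all add: P_def N_def)
  obtain vP lP where sP: "spectral n (lap n P) vP lP"
    by (rule lap_spectral_exists[of P n, OF symPN(1)])
  obtain vN lN where sN: "spectral n (lap n N) vN lN"
    by (rule lap_spectral_exists[of N n, OF symPN(2)])
  \<comment> \<open>With no positive eigenvalues, the rank is the number of negative ones.\<close>
  have rank: "n \<le> card {k\<in>{..<n}. lM k = 0} + card {k\<in>{..<n}. - lM k > 0}"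
    if "spectral n (lap n M) vM lM" "\<And>i j. M i j = M j i" "\<And>i j. M i j \<ge> 0" for M vM lM
  proof -
    have "{k\<in>{..<n}. lM k > 0} = {}" using lap_eigenvalue_nonpos[OF that(2,3,1)] by force
    moreover have "{k\<in>{..<n}. - lM k > 0} = {k\<in>{..<n}. lM k < 0}" by auto
    ultimately show ?thesis using card_sign_partition[of n lM] by (simp only: card.empty)
  qed
  \<comment> \<open>The matrix \<open>- lap n N\<close> is positive semidefinite, so its positive
    index is its rank. Adding a small multiple of \<open>P\<close> restores the sign pattern of
    \<open>a\<close> without lowering that index.\<close>
  have "card {k\<in>{..<n}. - lN k > 0} \<le> card {k\<in>{..<n}. l k > 0}"
  proof -
    obtain t where t: "t > 0" "\<forall>v' l'. spectral n (\<lambda>i j. - lap n N i j + t * lap n P i j) v' l' \<longrightarrow>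
        card {k\<in>{..<n}. - lN k > 0} \<le> card {k\<in>{..<n}. l' k > 0}"
      using positive_index_lower_semicontinuous[OF spectral_uminus[OF sN], of "lap n P",
            OF lap_symmetric[OF symPN(1)]]
      by auto
    define b where "b = (\<lambda>i j. - N i j + t * P i j)"
    have b1: "b i j = b j i" for i j using symPN[of i j] by (simp add: b_def)
    have b2: "sgn (b i j) = sgn (a i j)" for i j
      using t(1) by (cases "a i j" "0 :: real" rule: linorder_cases)
        (simp_all add: b_def P_def N_def sgn_mult)
    have lb: "lap n b = (\<lambda>i j. - lap n N i j + t * lap n P i j)"
      unfolding b_def lap_add_scale lap_uminus ..
    obtain v' l' where s': "spectral n (lap n b) v' l'"
      by (rule lap_spectral_exists[of b n, OF b1])
    from const[OF b1 b2 s'] t(2)[rule_format, OF s'[unfolded lb]] show ?thesis by simp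
  qed
  moreover have "card {k\<in>{..<n}. - lP k > 0} \<le> card {k\<in>{..<n}. l k < 0}"
  proof -
    obtain t where t: "t > 0" "\<forall>v' l'. spectral n (\<lambda>i j. - lap n P i j + t * lap n N i j) v' l' \<longrightarrow>
        card {k\<in>{..<n}. - lP k > 0} \<le> card {k\<in>{..<n}. l' k > 0}"
      using positive_index_lower_semicontinuous[OF spectral_uminus[OF sP], of "lap n N",
            OF lap_symmetric[OF symPN(2)]]
      by auto
    \<comment> \<open>The outer negation gives \<open>b\<close> the signs of \<open>a\<close>;
      negative eigenvalues of \<open>lap n b\<close> are positive ones of the perturbed
      matrix.\<close>
    define b where "b = (\<lambda>i j. - (- P i j + t * N i j))"
    have b1: "b i j = b j i" for i j using symPN[of i j] by (simp add: b_def)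
    have b2: "sgn (b i j) = sgn (a i j)" for i j
      using t(1) by (cases "a i j" "0 :: real" rule: linorder_cases)
        (simp_all add: b_def P_def N_def sgn_mult)
    have lb: "lap n b = (\<lambda>i j. - (- lap n P i j + t * lap n N i j))"
      unfolding b_def lap_uminus lap_add_scale ..
    obtain v' l' where s': "spectral n (lap n b) v' l'"
      by (rule lap_spectral_exists[of b n, OF b1])
    have "spectral n (\<lambda>i j. - lap n P i j + t * lap n N i j) v' (\<lambda>k. - l' k)"
      using spectral_uminus[OF s'[unfolded lb]] by simp
    from const[OF b1 b2 s'] t(2)[rule_format, OF this] show ?thesis by simp
  qed
  \<comment> \<open>The two nullities add up to at least 2n minus the positive and negative indices
    of \<open>lap n a\<close>, which is n plus its nullity.\<close>
  ultimately have dim: "n + card {k\<in>{..<n}. l k = 0} \<le>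
      card {k\<in>{..<n}. lP k = 0} + card {k\<in>{..<n}. lN k = 0}"
    using rank[OF sP symPN(1) nn(1)] rank[OF sN symPN(2) nn(2)] card_sign_partition[of n l] by linarith
  have lap_a: "lap n a = (\<lambda>i j. lap n P i j + (- 1) * lap n N i j)"
    unfolding lap_add_scale[symmetric] by (rule arg_cong[of _ _ "lap n"]) (auto simp: fun_eq_iff P_def N_def max_def)
  have common: "app n (lap n a) w i = 0"
    if "\<And>i. i < n \<Longrightarrow> app n (lap n P) w i = 0" "\<And>i. i < n \<Longrightarrow> app n (lap n N) w i = 0" "i < n" for w i
    using that(1)[OF that(3)] that(2)[OF that(3)]
    unfolding lap_a app_def by (simp add: left_diff_distrib sum_subtractf)
  obtain z where z: "\<And>i. i < n \<Longrightarrow> app n (lap n P) z i = 0"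
    "\<And>i. i < n \<Longrightarrow> app n (lap n N) (\<lambda>i. x i - z i) i = 0"
    using kernel_decomposition[OF s sP sN common dim] by blast
  have "z i = z j" if "i < n" "j < n" "a i j > 0" for i j
    using lap_kernel_constant[OF symPN(1) nn(1) z(1) that(1,2)] that by (simp add: P_def)
  moreover have "z i - z j = x i - x j" if "i < n" "j < n" "a i j < 0" for i j
    using lap_kernel_constant[OF symPN(2) nn(2) z(2) that(1,2)] that by (simp add: N_def)
  ultimately show "\<exists>z. \<forall>i<n. \<forall>j<n. (a i j > 0 \<longrightarrow> z i = z j) \<and> (a i j < 0 \<longrightarrow> z i - z j = x i - x j)"
    by blast
qed

section \<open>Blocks and splittings of potentials\<close>

text \<open>Weight-free counterpart of \<open>separates_signs\<close>, suited to passing to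
  subgraphs.\<close>

definition splits_potentials :: "('a set \<Rightarrow> sign) \<Rightarrow> 'a ugraph \<Rightarrow> bool" where
  "splits_potentials s H \<longleftrightarrow> (\<forall>x::'a \<Rightarrow> real. \<exists>z. \<forall>i j. {i, j} \<in> edges H \<longrightarrow>
     (s {i, j} = Positive \<longrightarrow> z i = z j) \<and> (s {i, j} = Negative \<longrightarrow> z i - z j = x i - x j))"

definition mixed :: "('a set \<Rightarrow> sign) \<Rightarrow> 'a ugraph \<Rightarrow> bool" where
  "mixed s H \<longleftrightarrow> (\<exists>e\<in>edges H. s e = Positive) \<and> (\<exists>e\<in>edges H. s e = Negative)"

definition induced :: "'a ugraph \<Rightarrow> 'a set \<Rightarrow> 'a ugraph" where
  "induced H W = \<lparr>verts = W, edges = {e \<in> edges H. e \<subseteq> W}\<rparr>"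

lemma subgraph_induced:
  assumes "simple_graph H" "W \<subseteq> verts H"
  shows "subgraph (induced H W) H"
  using assms by (auto simp: subgraph_def induced_def simple_graph_def intro: finite_subset)

lemma subgraph_trans: "subgraph A B \<Longrightarrow> subgraph B C \<Longrightarrow> subgraph A C"
  by (auto simp: subgraph_def)

text \<open>A splitting survives adding a constant to \<open>z\<close>. Normalising both pieces to
  vanish at the possible common vertex \<open>v\<close> makes them agree on the overlap.\<close>

lemma splits_potentials_glue:
  assumes split: "splits_potentials s (induced H V1)" "splits_potentials s (induced H V2)"
    and "V1 \<inter> V2 \<subseteq> {v}"
    and cover: "\<And>e. e \<in> edges H \<Longrightarrow> e \<subseteq> V1 \<or> e \<subseteq> V2"
  shows "splits_potentials s H"
  unfolding splits_potentials_def
proof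
  fix x :: "'a \<Rightarrow> real"
  from split(1) obtain z1 where z1: "\<And>i j. {i, j} \<in> edges H \<Longrightarrow> {i, j} \<subseteq> V1 \<Longrightarrow>
     (s {i, j} = Positive \<longrightarrow> z1 i = z1 j) \<and> (s {i, j} = Negative \<longrightarrow> z1 i - z1 j = x i - x j)"
    unfolding splits_potentials_def induced_def by (simp, blast)
  from split(2) obtain z2 where z2: "\<And>i j. {i, j} \<in> edges H \<Longrightarrow> {i, j} \<subseteq> V2 \<Longrightarrow>
     (s {i, j} = Positive \<longrightarrow> z2 i = z2 j) \<and> (s {i, j} = Negative \<longrightarrow> z2 i - z2 j = x i - x j)"
    unfolding splits_potentials_def induced_def by (simp, blast)
  define z where "z = (\<lambda>i. if i \<in> V1 then z1 i - z1 v else z2 i - z2 v)"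
  have zV2: "z i = z2 i - z2 v" if "i \<in> V2" for i
    using that \<open>V1 \<inter> V2 \<subseteq> {v}\<close> by (auto simp: z_def)
  have "(s {i, j} = Positive \<longrightarrow> z i = z j) \<and> (s {i, j} = Negative \<longrightarrow> z i - z j = x i - x j)"
    if e: "{i, j} \<in> edges H" for i j
  proof (cases "{i, j} \<subseteq> V1")
    case True
    then show ?thesis using z1[OF e True] by (simp add: z_def)
  next
    case False
    then have "{i, j} \<subseteq> V2" using cover[OF e] by blast
    then show ?thesis using z2[OF e] by (simp add: zV2)
  qed
  then show "\<exists>z. \<forall>i j. {i, j} \<in> edges H \<longrightarrow>
     (s {i, j} = Positive \<longrightarrow> z i = z j) \<and> (s {i, j} = Negative \<longrightarrow> z i - z j = x i - x j)"
    by blast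
qed

section \<open>Separating a graph at a component or a cut vertex\<close>

lemma joined_step:
  assumes "simple_graph H" "joined H u a" "{a, b} \<in> edges H"
  shows "joined H u b"
  using assms by (auto simp: joined_def simple_graph_def intro: rtrancl_into_rtrancl)

lemma simple_graph_delete_vertex: "simple_graph H \<Longrightarrow> simple_graph (delete_vertex H v)"
  by (auto simp: simple_graph_def delete_vertex_def)

lemma edge_doubleton:
  assumes "simple_graph H" "e \<in> edges H"
  obtains a b where "e = {a, b}" "a \<noteq> b" "a \<in> verts H" "b \<in> verts H"
  using assms unfolding simple_graph_def card_2_iff by (metis insert_subset)

text \<open>A disconnected graph separates into a component and its complement. At a cut vertex
  \<open>v\<close>, one side is a component of the graph without \<open>v\<close>, with
  \<open>v\<close> added, and the other the complement of that component. Two vertices that are not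
  joined keep both sides proper.\<close>

lemma separation:
  assumes H: "simple_graph H" "verts H \<noteq> {}" and "\<not> connected_no_cut H"
  obtains V1 V2 v where "V1 \<subset> verts H" "V2 \<subset> verts H" "V1 \<inter> V2 \<subseteq> {v}"
    "\<And>e. e \<in> edges H \<Longrightarrow> e \<subseteq> V1 \<or> e \<subseteq> V2"
proof (cases "connected_graph H")
  case False
  then obtain u w where uw: "u \<in> verts H" "w \<in> verts H" "\<not> joined H u w"
    using H by (auto simp: connected_graph_def)
  define V where "V = {y \<in> verts H. joined H u y}"
  have "u \<in> V" "w \<notin> V" using uw by (auto simp: V_def joined_def)
  moreover have "e \<subseteq> V \<or> e \<subseteq> verts H - V" if "e \<in> edges H" for e
  proof -
    obtain a b where e: "e = {a, b}" "a \<in> verts H" "b \<in> verts H"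
      using edge_doubleton[OF H(1) \<open>e \<in> edges H\<close>] by metis
    have "joined H u a \<longleftrightarrow> joined H u b"
      using joined_step[OF H(1), of u a b] joined_step[OF H(1), of u b a] \<open>e \<in> edges H\<close> e
      by (auto simp: insert_commute)
    then show ?thesis using e by (auto simp: V_def)
  qed
  \<comment> \<open>The two sides are disjoint here, so \<open>u\<close> merely fills the place of
    the common vertex.\<close>
  ultimately show ?thesis
    using that[of V "verts H - V" u] uw by (auto simp: V_def)
next
  case True
  then obtain v where v: "cut_vertex H v" using assms by (auto simp: connected_no_cut_def)
  let ?D = "delete_vertex H v"
  obtain u w where uw: "u \<in> verts H - {v}" "w \<in> verts H - {v}" "\<not> joined ?D u w"
    using v by (auto simp: cut_vertex_def)
  define V where "V = {y \<in> verts H. joined ?D u y}"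
  have V: "u \<in> V" "w \<notin> V" "v \<notin> V" using uw by (auto simp: V_def joined_def delete_vertex_def)
  have "e \<subseteq> insert v V \<or> e \<subseteq> verts H - V" if "e \<in> edges H" for e
  proof -
    obtain a b where e: "e = {a, b}" "a \<in> verts H" "b \<in> verts H"
      using edge_doubleton[OF H(1) \<open>e \<in> edges H\<close>] by metis
    show ?thesis
    proof (cases "v \<in> e")
      case True
      then show ?thesis using e V(3) by auto
    next
      case False
      then have "{a, b} \<in> edges ?D" "{b, a} \<in> edges ?D"
        using \<open>e \<in> edges H\<close> e by (auto simp: delete_vertex_def insert_commute)
      then have "joined ?D u a \<longleftrightarrow> joined ?D u b"
        using joined_step[OF simple_graph_delete_vertex[OF H(1)]] by blast
      then show ?thesis using e by (auto simp: V_def)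
    qed
  qed
  moreover have "v \<in> verts H" using v by (simp add: cut_vertex_def)
  ultimately show ?thesis
    using that[of "insert v V" "verts H - V" v] uw V by (auto simp: V_def)
qed

text \<open>Induction on the number of vertices, gluing the two sides of a separation. The
  hypothesis concerns all connected subgraphs without cut vertex because this passes to induced
  subgraphs, whose blocks need not be blocks of \<open>H\<close>.\<close>

lemma splits_potentials_if_not_mixed:
  assumes "simple_graph H"
    and "\<And>B. subgraph B H \<Longrightarrow> connected_no_cut B \<Longrightarrow> \<not> mixed s B"
  shows "splits_potentials s H"
  using assms
proof (induction "card (verts H)" arbitrary: H rule: less_induct)
  case less
  consider "verts H = {}" | "connected_no_cut H" | "verts H \<noteq> {}" "\<not> connected_no_cut H" by blast
  then show ?case
  proof cases
    case 1
    then have "edges H = {}" using less.prems(1) by (fastforce simp: simple_graph_def)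
    then show ?thesis by (simp add: splits_potentials_def)
  next
    case 2
    have "\<not> mixed s H" using 2 less.prems by (simp add: subgraph_def)
    \<comment> \<open>Without negative edges \<open>z = 0\<close> works, without positive ones
      \<open>z = x\<close>.\<close>
    then consider "\<And>e. e \<in> edges H \<Longrightarrow> s e \<noteq> Negative" | "\<And>e. e \<in> edges H \<Longrightarrow> s e \<noteq> Positive"
      unfolding mixed_def by blast
    then show ?thesis
    proof cases
      case 1
      then show ?thesis unfolding splits_potentials_def by (intro allI exI[of _ "\<lambda>_. 0"]) auto
    next
      case 2
      then show ?thesis unfolding splits_potentials_def by blast
    qed
  next
    case 3
    then obtain V1 V2 v where V: "V1 \<subset> verts H" "V2 \<subset> verts H" "V1 \<inter> V2 \<subseteq> {v}"
      "\<And>e. e \<in> edges H \<Longrightarrow> e \<subseteq> V1 \<or> e \<subseteq> V2"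
      using separation[OF less.prems(1)] by metis
    have "splits_potentials s (induced H W)" if "W \<subset> verts H" for W
    proof (rule less.hyps)
      have sub: "subgraph (induced H W) H" using subgraph_induced less.prems(1) that by blast
      then show "simple_graph (induced H W)" by (simp add: subgraph_def)
      show "card (verts (induced H W)) < card (verts H)"
        using that less.prems(1) by (simp add: induced_def simple_graph_def psubset_card_mono)
      show "\<not> mixed s B" if "subgraph B (induced H W)" "connected_no_cut B" for B
        using less.prems(2) subgraph_trans[OF that(1) sub] that(2) by blast
    qed
    from splits_potentials_glue[OF this[OF V(1)] this[OF V(2)] V(3,4)] show ?thesis .
  qed
qed

text \<open>If no vertex met both signs, the property of meeting a positive edge would propagate
  along a path from a positive edge to a negative one.\<close>

lemma mixed_vertex:
  assumes B: "simple_graph B" "connected_graph B" "mixed s B"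
  obtains v u w where "{v, u} \<in> edges B" "s {v, u} = Positive" "{v, w} \<in> edges B" "s {v, w} = Negative"
proof (rule ccontr)
  assume "\<not> thesis"
  then have none: "\<And>v u w. {v, u} \<in> edges B \<Longrightarrow> s {v, u} = Positive \<Longrightarrow> {v, w} \<in> edges B \<Longrightarrow>
      s {v, w} \<noteq> Negative"
    using that by blast
  from B(3) obtain e f where ef: "e \<in> edges B" "s e = Positive" "f \<in> edges B" "s f = Negative"
    by (auto simp: mixed_def)
  obtain a b where e: "e = {a, b}" "a \<in> verts B" using edge_doubleton[OF B(1) ef(1)] by metis
  obtain c d where f: "f = {c, d}" "c \<in> verts B" using edge_doubleton[OF B(1) ef(3)] by metis
  have "(a, c) \<in> {(x, y). {x, y} \<in> edges B}\<^sup>*"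
    using B(2) e f by (auto simp: connected_graph_def joined_def)
  then have "\<exists>u. {c, u} \<in> edges B \<and> s {c, u} = Positive"
  proof (induction rule: rtrancl_induct)
    case base
    then show ?case using ef e by auto
  next
    case (step y y')
    then obtain u where "{y, u} \<in> edges B" "s {y, u} = Positive" by blast
    then have "s {y, y'} = Positive" using none[of y u y'] step(2) by (cases "s {y, y'}") auto
    then show ?case using step(2) by (auto simp: insert_commute)
  qed
  then show False using none ef f by blast
qed

lemma not_splits_potentials_if_mixed:
  assumes B: "simple_graph B" "connected_no_cut B" "mixed s B"
  shows "\<not> splits_potentials s B"
proof
  assume split: "splits_potentials s B"
  have con: "connected_graph B" using B by (simp add: connected_no_cut_def)
  obtain v u w where e: "{v, u} \<in> edges B" "s {v, u} = Positive" "{v, w} \<in> edges B" "s {v, w} = Negative"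
    using mixed_vertex[OF B(1) con B(3)] by metis
  have V: "v \<in> verts B" "u \<in> verts B - {v}" "w \<in> verts B - {v}"
    using e B(1) by (auto simp: simple_graph_def)
  then have "joined B u w" using con by (simp add: connected_graph_def)
  with V B(2) have "joined (delete_vertex B v) u w"
    unfolding connected_no_cut_def cut_vertex_def by blast
  then have path: "(u, w) \<in> {(x, y). {x, y} \<in> edges B \<and> v \<notin> {x, y}}\<^sup>*"
    by (simp add: joined_def delete_vertex_def)
  define x :: "'a \<Rightarrow> real" where "x = (\<lambda>i. if i = v then 1 else 0)"
  obtain z where z: "\<And>i j. {i, j} \<in> edges B \<Longrightarrow>
     (s {i, j} = Positive \<longrightarrow> z i = z j) \<and> (s {i, j} = Negative \<longrightarrow> z i - z j = x i - x j)"
    using split unfolding splits_potentials_def by metis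
  \<comment> \<open>On edges avoiding \<open>v\<close> the indicator \<open>x\<close> has difference
    0, so either sign forces \<open>z\<close> to be constant.\<close>
  from path have "z w = z u"
  proof (induction rule: rtrancl_induct)
    case (step y y')
    then show ?case using z[of y y'] by (cases "s {y, y'}") (auto simp: x_def)
  qed simp
  moreover have "z v = z u" using z[OF e(1)] e(2) by simp
  moreover have "z v - z w = 1" using z[OF e(3)] e(4) V by (simp add: x_def)
  ultimately show False by simp
qed

section \<open>From subgraphs to blocks\<close>

lemma splits_potentials_subgraph:
  assumes "splits_potentials s H" "subgraph B H"
  shows "splits_potentials s B"
  unfolding splits_potentials_def
proof
  fix x :: "'a \<Rightarrow> real"
  obtain z where "\<forall>i j. {i, j} \<in> edges H \<longrightarrow>
     (s {i, j} = Positive \<longrightarrow> z i = z j) \<and> (s {i, j} = Negative \<longrightarrow> z i - z j = x i - x j)"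
    using assms unfolding splits_potentials_def by blast
  then show "\<exists>z. \<forall>i j. {i, j} \<in> edges B \<longrightarrow>
     (s {i, j} = Positive \<longrightarrow> z i = z j) \<and> (s {i, j} = Negative \<longrightarrow> z i - z j = x i - x j)"
    using assms(2) unfolding subgraph_def by blast
qed

text \<open>Finiteness gives an extension of largest size. The size counts vertices and edges, since
  a larger subgraph may add edges only.\<close>

lemma contained_in_block:
  assumes G: "simple_graph G" and B: "subgraph B G" "connected_no_cut B"
  obtains M where "block G M" "subgraph B M"
proof -
  define P where "P = (\<lambda>M. subgraph M G \<and> connected_no_cut M \<and> subgraph B M)"
  define m where "m = (\<lambda>M::'a ugraph. card (verts M) + card (edges M))"
  have fin: "finite (verts M)" "finite (edges M)" if "simple_graph M" for M :: "'a ugraph"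
  proof -
    show "finite (verts M)" using that by (simp add: simple_graph_def)
    moreover have "edges M \<subseteq> Pow (verts M)" using that by (auto simp: simple_graph_def)
    ultimately show "finite (edges M)" by (meson finite_Pow_iff finite_subset)
  qed
  have "P B" using B by (auto simp: P_def subgraph_def)
  moreover have "\<forall>M. P M \<longrightarrow> m M < Suc (m G)"
    using fin[OF G] by (auto simp: P_def m_def subgraph_def less_Suc_eq_le intro!: add_mono card_mono)
  ultimately have "\<exists>M. P M \<and> (\<forall>M'. P M' \<longrightarrow> m M' \<le> m M)"
    by (rule ex_has_greatest_nat)
  then obtain M where M: "P M" "\<And>M'. P M' \<Longrightarrow> m M' \<le> m M" by blast
  have "B' = M" if B': "subgraph B' G" "connected_no_cut B'" "subgraph M B'" for B'
  proof -
    have le: "m B' \<le> m M" using M B' subgraph_trans[of B M B'] by (auto simp: P_def)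
    have sub: "verts M \<subseteq> verts B'" "edges M \<subseteq> edges B'" using B' by (auto simp: subgraph_def)
    have f: "finite (verts B')" "finite (edges B')" using fin[of B'] B' by (auto simp: subgraph_def)
    have "verts M = verts B'" "edges M = edges B'"
      using card_mono[OF f(1) sub(1)] card_mono[OF f(2) sub(2)] le card_seteq[OF f(1) sub(1)]
        card_seteq[OF f(2) sub(2)] by (auto simp: m_def)
    then show ?thesis by simp
  qed
  then have "block G M" using M by (simp add: P_def block_def)
  with M show ?thesis using that by (simp add: P_def)
qed

lemma splits_potentials_iff_no_mixed_block:
  assumes "simple_graph G"
  shows "splits_potentials s G \<longleftrightarrow> \<not> (\<exists>B. block G B \<and> mixed s B)"
proof
  assume "splits_potentials s G"
  then show "\<not> (\<exists>B. block G B \<and> mixed s B)"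
    using splits_potentials_subgraph not_splits_potentials_if_mixed
    unfolding block_def subgraph_def by blast
next
  assume no: "\<not> (\<exists>B. block G B \<and> mixed s B)"
  show "splits_potentials s G"
  proof (rule splits_potentials_if_not_mixed[OF assms])
    fix B assume "subgraph B G" "connected_no_cut B"
    then obtain M where M: "block G M" "subgraph B M" using contained_in_block[OF assms] by metis
    then have "\<not> mixed s M" using no by blast
    with M(2) show "\<not> mixed s B" by (auto simp: mixed_def subgraph_def)
  qed
qed

section \<open>Inertia of signed graphs\<close>

definition edge_weights :: "signed_graph \<Rightarrow> (nat set \<Rightarrow> real) \<Rightarrow> nat \<Rightarrow> nat \<Rightarrow> real" where
  "edge_weights G \<gamma> i j = (if {i, j} \<in> edges G then \<gamma> {i, j} else 0)"

lemma edge_weights_symmetric: "edge_weights G \<gamma> i j = edge_weights G \<gamma> j i"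
  by (simp add: edge_weights_def insert_commute)

lemma signed_graph_on_edge:
  assumes "signed_graph_on n G" "{i, j} \<in> edges G"
  shows "i < n" "j < n" "i \<noteq> j"
proof -
  have "{i, j} \<subseteq> {..<n}" "card {i, j} = 2"
    using assms by (auto simp: signed_graph_on_def simple_graph_def underlying_def)
  then show "i < n" "j < n" "i \<noteq> j" by (auto simp: card_2_iff)
qed

lemma signed_graph_on_edge_doubleton:
  assumes "signed_graph_on n G" "e \<in> edges G"
  obtains i j where "e = {i, j}"
proof -
  have "card e = 2"
    using assms by (auto simp: signed_graph_on_def simple_graph_def underlying_def)
  then show ?thesis using that by (auto simp: card_2_iff)
qed

lemma laplacian_eq_lap:
  assumes G: "signed_graph_on n G"
  shows "laplacian n G \<gamma> = mat n n (\<lambda>(i, j). lap n (edge_weights G \<gamma>) i j)"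
proof -
  have deg: "(\<Sum>e | e \<in> edges G \<and> i \<in> e. \<gamma> e) = (\<Sum>k<n. edge_weights G \<gamma> i k)" for i
  proof -
    \<comment> \<open>Incident edges are parametrised by their other endpoint, turning the degree
      into a row sum.\<close>
    have "{e \<in> edges G. i \<in> e} = (\<lambda>k. {i, k}) ` {k\<in>{..<n}. {i, k} \<in> edges G}"
    proof (intro equalityI subsetI)
      fix e assume e: "e \<in> {e \<in> edges G. i \<in> e}"
      then obtain a b where "e = {a, b}"
        using signed_graph_on_edge_doubleton[OF G] by blast
      with e obtain k where "e = {i, k}" by auto
      with e signed_graph_on_edge[OF G, of i k]
      show "e \<in> (\<lambda>k. {i, k}) ` {k\<in>{..<n}. {i, k} \<in> edges G}" by auto
    qed auto
    moreover have "inj_on (\<lambda>k. {i, k}) {k\<in>{..<n}. {i, k} \<in> edges G}"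
      by (auto simp: inj_on_def doubleton_eq_iff)
    ultimately have "(\<Sum>e | e \<in> edges G \<and> i \<in> e. \<gamma> e) = (\<Sum>k\<in>{k\<in>{..<n}. {i, k} \<in> edges G}. \<gamma> {i, k})"
      by (simp add: sum.reindex)
    also have "\<dots> = (\<Sum>k<n. edge_weights G \<gamma> i k)"
      by (simp add: edge_weights_def sum.If_cases Int_def)
    finally show ?thesis .
  qed
  show ?thesis
    by (rule eq_matI)
      (auto simp: laplacian_def weighted_adjacency_def weighted_degree_def lap_def deg edge_weights_def)
qed

lemma laplacian_inertia_spectral:
  assumes "signed_graph_on n G" "spectral n (lap n (edge_weights G \<gamma>)) v l"
  shows "laplacian_inertia n G \<gamma> = (card {k\<in>{..<n}. l k > 0}, card {k\<in>{..<n}. l k < 0},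
    card {k\<in>{..<n}. l k = 0})"
proof -
  have "spectral n (\<lambda>i j. laplacian n G \<gamma> $$ (i, j)) v l"
    using assms(2) by (simp add: laplacian_eq_lap[OF assms(1)] spectral_def)
  moreover have "laplacian n G \<gamma> \<in> carrier_mat n n" by (simp add: laplacian_eq_lap[OF assms(1)])
  ultimately show ?thesis
    by (simp add: laplacian_inertia_def eigenvalue_count_spectral)
qed

text \<open>Reference weighting: its edge weights are the sign pattern shared by all consistent
  weightings.\<close>

definition sign_weight :: "signed_graph \<Rightarrow> nat set \<Rightarrow> real" where
  "sign_weight G e = (case edge_sign G e of Positive \<Rightarrow> 1 | Negative \<Rightarrow> -1)"

lemma consistent_sign_weight: "consistent_weighting G (sign_weight G)"
  by (auto simp: consistent_weighting_def sign_weight_def split: sign.split)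

lemma sgn_edge_weights:
  assumes "consistent_weighting G \<gamma>"
  shows "sgn (edge_weights G \<gamma> i j) = edge_weights G (sign_weight G) i j"
  using assms by (auto simp: consistent_weighting_def edge_weights_def sign_weight_def
      split: sign.splits)

lemma separates_signs_edge_weights:
  assumes G: "signed_graph_on n G" and \<gamma>: "consistent_weighting G \<gamma>"
  shows "separates_signs n (edge_weights G \<gamma>) \<longleftrightarrow> splits_potentials (edge_sign G) (underlying G)"
proof -
  have "(\<forall>i<n. \<forall>j<n. (edge_weights G \<gamma> i j > 0 \<longrightarrow> z i = z j) \<and>
      (edge_weights G \<gamma> i j < 0 \<longrightarrow> z i - z j = x i - x j)) \<longleftrightarrow>
    (\<forall>i j. {i, j} \<in> edges G \<longrightarrow> (edge_sign G {i, j} = Positive \<longrightarrow> z i = z j) \<and>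
      (edge_sign G {i, j} = Negative \<longrightarrow> z i - z j = x i - x j))" (is "?L \<longleftrightarrow> ?R") for x z :: "nat \<Rightarrow> real"
  proof -
    have pos: "edge_weights G \<gamma> i j > 0 \<longleftrightarrow> {i, j} \<in> edges G \<and> edge_sign G {i, j} = Positive"
      and neg: "edge_weights G \<gamma> i j < 0 \<longleftrightarrow> {i, j} \<in> edges G \<and> edge_sign G {i, j} = Negative" for i j
      using \<gamma> by (cases "edge_sign G {i, j}";
          force simp: consistent_weighting_def edge_weights_def)+
    show ?thesis unfolding pos neg using signed_graph_on_edge[OF G] by blast
  qed
  then show ?thesis by (simp add: separates_signs_def splits_potentials_def underlying_def)
qed

lemma unique_laplacian_inertia_iff:
  assumes G: "signed_graph_on n G"
  shows "unique_laplacian_inertia n G \<longleftrightarrow> splits_potentials (edge_sign G) (underlying G)"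
proof
  assume uniq: "unique_laplacian_inertia n G"
  let ?a = "edge_weights G (sign_weight G)"
  obtain v l where s: "spectral n (lap n ?a) v l"
    by (rule lap_spectral_exists[of ?a n, OF edge_weights_symmetric])
  have "separates_signs n ?a"
  proof (rule separates_signs_if_constant_inertia[OF edge_weights_symmetric s])
    fix b v' l'
    assume sym: "\<And>i j. b i j = b j i" and sgn: "\<And>i j. sgn (b i j) = sgn (?a i j)"
      and s': "spectral n (lap n b) v' l'"
    \<comment> \<open>The endpoints of an edge are recovered as \<open>Min\<close> and
      \<open>Max\<close>; symmetry of \<open>b\<close> makes their order irrelevant.\<close>
    define \<gamma> where "\<gamma> = (\<lambda>e. b (Min e) (Max e))"
    have \<gamma>: "\<gamma> {i, j} = b i j" for i j
      using sym by (auto simp: \<gamma>_def min_def max_def)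
    have b: "edge_weights G \<gamma> = b"
    proof (intro ext)
      fix i j
      show "edge_weights G \<gamma> i j = b i j"
        using sgn[of i j] by (auto simp: edge_weights_def \<gamma> sgn_zero_iff)
    qed
    have "consistent_weighting G \<gamma>"
      unfolding consistent_weighting_def
    proof
      fix e assume e: "e \<in> edges G"
      then obtain i j where "e = {i, j}"
        using signed_graph_on_edge_doubleton[OF G] by blast
      then show "case edge_sign G e of Positive \<Rightarrow> 0 < \<gamma> e | Negative \<Rightarrow> \<gamma> e < 0"
        using sgn[of i j] e
        by (auto simp: \<gamma> edge_weights_def sign_weight_def sgn_1_pos sgn_1_neg split: sign.splits)
    qed
    then have "laplacian_inertia n G \<gamma> = laplacian_inertia n G (sign_weight G)"
      using uniq consistent_sign_weight unfolding unique_laplacian_inertia_def by blast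
    then show "card {k\<in>{..<n}. l' k > 0} = card {k\<in>{..<n}. l k > 0} \<and>
      card {k\<in>{..<n}. l' k < 0} = card {k\<in>{..<n}. l k < 0}"
      using laplacian_inertia_spectral[OF G, of \<gamma> v' l'] laplacian_inertia_spectral[OF G s] s'
      by (simp add: b)
  qed
  then show "splits_potentials (edge_sign G) (underlying G)"
    using separates_signs_edge_weights[OF G consistent_sign_weight] by simp
next
  assume split: "splits_potentials (edge_sign G) (underlying G)"
  have le: "card {k\<in>{..<n}. l k > 0} \<le> card {k\<in>{..<n}. l' k > 0}"
      "card {k\<in>{..<n}. l k < 0} \<le> card {k\<in>{..<n}. l' k < 0}"
    if \<gamma>: "consistent_weighting G \<gamma>" "consistent_weighting G \<gamma>'"
      and s: "spectral n (lap n (edge_weights G \<gamma>)) v l"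
      and s': "spectral n (lap n (edge_weights G \<gamma>')) v' l'" for \<gamma> \<gamma>' v l v' l'
  proof -
    have sep: "separates_signs n (edge_weights G \<gamma>)"
      using separates_signs_edge_weights[OF G \<gamma>(1)] split by simp
    have sgn: "sgn (edge_weights G \<gamma> i j) = sgn (edge_weights G \<gamma>' i j)" for i j
      by (simp add: sgn_edge_weights \<gamma>)
    show "card {k\<in>{..<n}. l k > 0} \<le> card {k\<in>{..<n}. l' k > 0}"
      by (rule positive_index_le[OF sep edge_weights_symmetric edge_weights_symmetric sgn s s'])
    \<comment> \<open>Negating the weights exchanges positive and negative eigenvalues.\<close>
    have "card {k\<in>{..<n}. - l k > 0} \<le> card {k\<in>{..<n}. - l' k > 0}"
    proof (rule positive_index_le[OF separates_signs_uminus[OF sep]])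
      show "spectral n (lap n (\<lambda>i j. - edge_weights G \<gamma> i j)) v (\<lambda>k. - l k)"
        "spectral n (lap n (\<lambda>i j. - edge_weights G \<gamma>' i j)) v' (\<lambda>k. - l' k)"
        unfolding lap_uminus by (rule spectral_uminus[OF s] spectral_uminus[OF s'])+
    qed (simp_all add: edge_weights_symmetric sgn sgn_minus)
    then show "card {k\<in>{..<n}. l k < 0} \<le> card {k\<in>{..<n}. l' k < 0}" by simp
  qed
  show "unique_laplacian_inertia n G"
    unfolding unique_laplacian_inertia_def
  proof (intro allI impI; elim conjE)
    fix \<gamma> \<gamma>' assume \<gamma>: "consistent_weighting G \<gamma>" "consistent_weighting G \<gamma>'"
    obtain v l where s: "spectral n (lap n (edge_weights G \<gamma>)) v l"
      by (rule lap_spectral_exists[of "edge_weights G \<gamma>" n, OF edge_weights_symmetric])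
    obtain v' l' where s': "spectral n (lap n (edge_weights G \<gamma>')) v' l'"
      by (rule lap_spectral_exists[of "edge_weights G \<gamma>'" n, OF edge_weights_symmetric])
    \<comment> \<open>Exchanging the weightings turns the inequalities into equalities; the zero
      counts agree because the three counts add up to \<open>n\<close>.\<close>
    show "laplacian_inertia n G \<gamma> = laplacian_inertia n G \<gamma>'"
      using le[OF \<gamma> s s'] le[OF \<gamma>(2,1) s' s] card_sign_partition[of n l] card_sign_partition[of n l']
      unfolding laplacian_inertia_spectral[OF G s] laplacian_inertia_spectral[OF G s'] by simp
  qed
qed

theorem corollary2p6:
  fixes n :: nat and G :: signed_graph
  assumes "signed_graph_on n G"
  shows "unique_laplacian_inertia n G \<longleftrightarrow>
    \<not> (\<exists>B. block (underlying G) B \<and>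
          (\<exists>e\<in>edges B. edge_sign G e = Positive) \<and> (\<exists>e\<in>edges B. edge_sign G e = Negative))"
proof -
  have "simple_graph (underlying G)" using assms by (simp add: signed_graph_on_def)
  then show ?thesis
    unfolding unique_laplacian_inertia_iff[OF assms]
    by (simp add: splits_potentials_iff_no_mixed_block mixed_def)
qed

end
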